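(* Let $N\ge 2$. For $0\le\lambda\le\left(\frac{N-1}{2}\right)^2$ put $\gamma_N(\lambda):=\sqrt{(N-1)^2-4\lambda}$, $h_N(\lambda):=\frac{\gamma_N(\lambda)+1}{2}$ and $\Psi_\lambda(r):=r^{-\frac{N-2}{2}}\left(\frac{\sinh r}{r}\right)^{-\frac{N-1+\gamma_N(\lambda)}{2}}$ for $r>0$. Then for all $0\le\lambda\le\left(\frac{N-1}{2}\right)^2$ and all $u\in C_c^\infty(\mathbb{H}^N\setminus\{x_0\})$ (not necessarily radial), $$\begin{aligned}\int_{\mathbb{H}^N}|\Delta_{r,\mathbb{H}^N}u|^2\,dv_{\mathbb{H}^N}={}&\lambda\int_{\mathbb{H}^N}|\nabla_{r,\mathbb{H}^N}u|^2\,dv_{\mathbb{H}^N}+h_N^2(\lambda)\int_{\mathbb{H}^N}\frac{|\nabla_{r,\mathbb{H}^N}u|^2}{r^2}\,dv_{\mathbb{H}^N}\\&+\left[\left(\frac N2\right)^2-h_N^2(\lambda)\right]\int_{\mathbb{H}^N}\frac{|\nabla_{r,\mathbb{H}^N}u|^2}{\sinh^2 r}\,dv_{\mathbb{H}^N}\\&+\gamma_N(\lambda)h_N(\lambda)\int_{\mathbb{H}^N}\frac{r\coth r-1}{r^2}|\nabla_{r,\mathbb{H}^N}u|^2\,dv_{\mathbb{H}^N}\\&+\int_{\mathbb{H}^N}(\Psi_\lambda(r))^2\left|\nabla_{r,\mathbb{H}^N}\left(\frac{u_r}{\Psi_\lambda(r)}\right)\right|^2dv_{\mathbb{H}^N}.\end{aligned}$$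 Furthermore, for $N\ge5$ and any given such $\lambda$, the constants $h_N^2(\lambda)$ and $\left(\frac N2\right)^2-h_N^2(\lambda)$ are jointly sharp in the following sense: with $h_N^2(\lambda)$ kept fixed, for every constant $C>\left(\frac N2\right)^2-h_N^2(\lambda)$ the inequality $$\begin{aligned}\int_{\mathbb{H}^N}|\Delta_{r,\mathbb{H}^N}u|^2\,dv_{\mathbb{H}^N}\ge{}&\lambda\int_{\mathbb{H}^N}|\nabla_{r,\mathbb{H}^N}u|^2\,dv_{\mathbb{H}^N}+h_N^2(\lambda)\int_{\mathbb{H}^N}\frac{|\nabla_{r,\mathbb{H}^N}u|^2}{r^2}\,dv_{\mathbb{H}^N}+C\int_{\mathbb{H}^N}\frac{|\nabla_{r,\mathbb{H}^N}u|^2}{\sinh^2 r}\,dv_{\mathbb{H}^N}\\&+\gamma_N(\lambda)h_N(\lambda)\int_{\mathbb{H}^N}\frac{r\coth r-1}{r^2}|\nabla_{r,\mathbb{H}^N}u|^2\,dv_{\mathbb{H}^N}\end{aligned}$$ fails for some $u\in C_c^\infty(\mathbb{H}^N\setminus\{x_0\})$.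
   Context: $\mathbb{H}^N$ is the $N$-dimensional hyperbolic space (constant curvature $-1$) with Riemannian volume $dv_{\mathbb{H}^N}$; $x_0\in\mathbb{H}^N$ is a fixed pole and $r=d(x,x_0)$ is the geodesic distance. In polar coordinates $x=(r,\Theta)\in(0,\infty)\times\mathbb{S}^{N-1}$ about $x_0$, $dv_{\mathbb{H}^N}=(\sinh r)^{N-1}\,dr\,d\Theta$. Functions are real-valued. For a function $u$ on $\mathbb{H}^N\setminus\{x_0\}$: $u_r=\frac{\partial u}{\partial r}$; the radial gradient is $\nabla_{r,\mathbb{H}^N}u=\left(\frac{\partial u}{\partial r},0\right)$, so $|\nabla_{r,\mathbb{H}^N}u|^2=u_r^2$; the radial Laplacian is $\Delta_{r,\mathbb{H}^N}u=\frac{1}{(\sinh r)^{N-1}}\frac{\partial}{\partial r}\left[(\sinh r)^{N-1}\frac{\partial u}{\partial r}\right]=u_{rr}+(N-1)\coth r\,u_r$. *)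

theory Defs
  imports "HOL-Analysis.Analysis"
begin

text \<open>
  Hyperbolic space of dimension \<open>N = CARD('n)\<close> is the upper sheet of the hyperboloid in
  Minkowski space, with an arbitrary point \<open>x0\<close> of it as pole.  Functions on it are represented
  by functions on the ambient space; nothing below looks at their values off the hyperboloid.
\<close>

type_synonym 'n mink = "(real ^ 'n) \<times> real"

definition mink_inner :: "'n::finite mink \<Rightarrow> 'n mink \<Rightarrow> real" where
  "mink_inner x y = fst x \<bullet> fst y - snd x * snd y"

definition hyperbolic_space :: "'n::finite mink set" where
  "hyperbolic_space = {x. mink_inner x x = - 1 \<and> snd x > 0}"

definition hyp_dist :: "'n::finite mink \<Rightarrow> 'n mink \<Rightarrow> real" where
  "hyp_dist x y = arcosh (- mink_inner x y)"

text \<open>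
  \<open>graph_chart\<close> is a global chart, \<open>chart_frame y i\<close> is its \<open>i\<close>-th partial derivative at \<open>y\<close>,
  \<open>chart_metric\<close> is the matrix of the induced metric, and \<open>hyp_volume\<close> has density
  \<open>sqrt (det g)\<close> in this chart.  The measure lives on the subspace \<open>hyperbolic_space\<close>, so that
  measurability of an integrand does not depend on its values off the hyperboloid.
\<close>

definition graph_chart :: "real ^ 'n \<Rightarrow> 'n::finite mink" where
  "graph_chart y = (y, sqrt (1 + y \<bullet> y))"

definition chart_frame :: "real ^ 'n \<Rightarrow> 'n \<Rightarrow> 'n::finite mink" where
  "chart_frame y i = (axis i 1, y $ i / sqrt (1 + y \<bullet> y))"

definition chart_metric :: "real ^ 'n \<Rightarrow> real ^ 'n ^ 'n::finite" where
  "chart_metric y = (\<chi> i j. mink_inner (chart_frame y i) (chart_frame y j))"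

definition hyp_volume :: "'n::finite mink measure" where
  "hyp_volume =
     distr (density lborel (\<lambda>y. ennreal (sqrt (det (chart_metric y)))))
       (restrict_space borel hyperbolic_space) graph_chart"

fun times_cont_diff_on :: "nat \<Rightarrow> (real ^ 'n) set \<Rightarrow> (real ^ 'n::finite \<Rightarrow> real) \<Rightarrow> bool" where
  "times_cont_diff_on 0 S f \<longleftrightarrow> continuous_on S f"
| "times_cont_diff_on (Suc k) S f \<longleftrightarrow>
     (\<forall>x\<in>S. f differentiable (at x)) \<and>
     (\<forall>v. times_cont_diff_on k S (\<lambda>x. frechet_derivative f (at x) v))"

definition smooth_on :: "(real ^ 'n) set \<Rightarrow> (real ^ 'n::finite \<Rightarrow> real) \<Rightarrow> bool" where
  "smooth_on S f \<longleftrightarrow> (\<forall>k. times_cont_diff_on k S f)"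

text \<open>
  Smooth functions with compact support in the hyperbolic space punctured at \<open>x0\<close>;
  their value at \<open>x0\<close> is unconstrained and irrelevant.
\<close>

definition test_functions :: "'n::finite mink \<Rightarrow> ('n mink \<Rightarrow> real) set" where
  "test_functions x0 =
     {u. smooth_on {y. graph_chart y \<noteq> x0} (\<lambda>y. u (graph_chart y)) \<and>
         (\<exists>K. compact K \<and> K \<subseteq> hyperbolic_space - {x0} \<and>
              (\<forall>x \<in> hyperbolic_space - {x0} - K. u x = 0))}"

text \<open>
  \<open>polar x0 r \<Theta>\<close> is the point with polar coordinates \<open>(r, \<Theta>)\<close>, where the direction \<open>\<Theta>\<close> is a unit
  tangent vector at \<open>x0\<close>: for fixed \<open>\<Theta>\<close> it is the unit speed geodesic from \<open>x0\<close> with initial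
  velocity \<open>\<Theta>\<close>.  \<open>polar_dir x0 x\<close> is the direction of \<open>x \<noteq> x0\<close>, so that
  \<open>x = polar x0 (hyp_dist x x0) (polar_dir x0 x)\<close>.
\<close>

definition polar :: "'n::finite mink \<Rightarrow> real \<Rightarrow> 'n mink \<Rightarrow> 'n mink" where
  "polar x0 r \<Theta> = cosh r *\<^sub>R x0 + sinh r *\<^sub>R \<Theta>"

definition polar_dir :: "'n::finite mink \<Rightarrow> 'n mink \<Rightarrow> 'n mink" where
  "polar_dir x0 x =
     (x - cosh (hyp_dist x x0) *\<^sub>R x0) /\<^sub>R sinh (hyp_dist x x0)"

definition radial_deriv :: "'n::finite mink \<Rightarrow> ('n mink \<Rightarrow> real) \<Rightarrow> 'n mink \<Rightarrow> real" where
  "radial_deriv x0 u x = deriv (\<lambda>s. u (polar x0 s (polar_dir x0 x))) (hyp_dist x x0)"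

text \<open>
  The radial gradient \<open>(u\<^sub>r, 0)\<close> is the tangent vector \<open>u\<^sub>r \<partial>\<^sub>r\<close>, where \<open>\<partial>\<^sub>r\<close> is the velocity
  of the radial geodesics; its Riemannian length is measured by the Minkowski form.
\<close>

definition radial_field :: "'n::finite mink \<Rightarrow> 'n mink \<Rightarrow> 'n mink" where
  "radial_field x0 x =
     sinh (hyp_dist x x0) *\<^sub>R x0 + cosh (hyp_dist x x0) *\<^sub>R polar_dir x0 x"

definition radial_grad :: "'n::finite mink \<Rightarrow> ('n mink \<Rightarrow> real) \<Rightarrow> 'n mink \<Rightarrow> 'n mink" where
  "radial_grad x0 u x = radial_deriv x0 u x *\<^sub>R radial_field x0 x"

definition sq_norm :: "'n::finite mink \<Rightarrow> real" where
  "sq_norm v = mink_inner v v"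

definition radial_laplacian :: "'n::finite mink \<Rightarrow> ('n mink \<Rightarrow> real) \<Rightarrow> 'n mink \<Rightarrow> real" where
  "radial_laplacian x0 u x =
     1 / sinh (hyp_dist x x0) ^ (CARD('n) - 1) *
     radial_deriv x0 (\<lambda>y. sinh (hyp_dist y x0) ^ (CARD('n) - 1) * radial_deriv x0 u y) x"

definition coth :: "real \<Rightarrow> real" where
  "coth r = cosh r / sinh r"

definition gam :: "nat \<Rightarrow> real \<Rightarrow> real" where
  "gam N lam = sqrt ((real N - 1)\<^sup>2 - 4 * lam)"

definition h :: "nat \<Rightarrow> real \<Rightarrow> real" where
  "h N lam = (gam N lam + 1) / 2"

definition Psi :: "nat \<Rightarrow> real \<Rightarrow> real \<Rightarrow> real" where
  "Psi N lam r =
     r powr (- ((real N - 2) / 2)) * (sinh r / r) powr (- ((real N - 1 + gam N lam) / 2))"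

end

(* In the chart given by the graph over the first factor the volume has density 1 / sqrt (1 + |y|^2), and
   the radial derivative of a function is its derivative along an explicit vector field with divergence
   (N - 1) coth r. The integral of the divergence of a compactly supported field vanishes by translation
   invariance of Lebesgue measure, and polar coordinates are not needed: the identity holds because the
   integrands on its two sides differ pointwise by the divergence of q(r) u_r^2 d/dr for an explicit q.
   For the sharpness, only the remainder has to be made small against the integral of u_r^2 / sinh^2 r.
   Near the pole u = r^(2 - N/2) eta(ln r / k) turns the ratio of the two into one of order k^-2. *)

theory Submission
  imports Defs "HOL-Real_Asymp.Real_Asymp"
begin

section \<open>Functions with continuous derivatives\<close>

text \<open>Put f = u_r, m = N - 1 and w = \<open>Psi_log_deriv\<close>, the logarithmic derivative
  of \<open>Psi\<close>. The remainder is (f' - w f)^2, the squared Laplacian is (f' + m coth r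
  f)^2, and their difference has the cross term 2 q f f' with q = m coth r + w. Subtracting the
  divergence q' f^2 + 2 q f f' + m coth r q f^2 leaves - (q' + w q) f^2. With w = h / r - b coth r
  and b = (N - 1 + gam) / 2, the relations b (N - 1 - b) = lam and coth^2 = 1 + 1 / sinh^2 split
  this into the four weights of the theorem. The obstacle is the pole: r, coth r and the radial
  direction are singular there, and u is arbitrary at \<open>x0\<close>. So the integration lemmas
  concern functions on the punctured chart that vanish outside a compact set missing the pole,
  extended by zero. For the sharpness, \<open>Psi\<close> behaves like r^(1 - N/2) at the pole, so
  the remainder is small if u_r is a slowly varying multiple of that power; u_r^2 / sinh^2 times the
  volume is then comparable to dr / r, which has infinite mass near the pole. Hence the exponent 2 -
  N/2 and the logarithmic variable.\<close>

lemma times_cont_diff_on_cong: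
  assumes "open S" and "\<And>x. x \<in> S \<Longrightarrow> f x = g x" and "times_cont_diff_on k S f"
  shows "times_cont_diff_on k S g"
  using assms(2,3)
proof (induction k arbitrary: f g)
  case 0
  then show ?case by (auto cong: continuous_on_cong)
next
  case (Suc k)
  have d: "(g has_derivative frechet_derivative f (at x)) (at x)" if "x \<in> S" for x
  proof -
    have "(f has_derivative frechet_derivative f (at x)) (at x)"
      using Suc.prems(2) that by (simp add: frechet_derivative_works)
    then show ?thesis
      using has_derivative_transform_within_open[OF _ assms(1) that] Suc.prems(1) by blast
  qed
  have "frechet_derivative f (at x) = frechet_derivative g (at x)" if "x \<in> S" for x
    using frechet_derivative_at[OF d[OF that]] .
  then have "times_cont_diff_on k S (\<lambda>x. frechet_derivative g (at x) v)" for v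
    using Suc.IH[of "\<lambda>x. frechet_derivative f (at x) v" "\<lambda>x. frechet_derivative g (at x) v"] Suc.prems(2)
    by simp
  then show ?case
    using d by (auto simp: differentiable_def)
qed

text \<open>Derivatives are unique, so any explicit candidate \<open>f'\<close> may stand in for the
  \<open>frechet_derivative\<close> of the recursive definition.\<close>

lemma times_cont_diff_on_SucI:
  assumes "open S" and "\<And>x. x \<in> S \<Longrightarrow> (f has_derivative f' x) (at x)"
    and "\<And>v. times_cont_diff_on k S (\<lambda>x. f' x v)"
  shows "times_cont_diff_on (Suc k) S f"
proof -
  have "f' x = frechet_derivative f (at x)" if "x \<in> S" for x
    using frechet_derivative_at[OF assms(2)[OF that]] .
  then have "times_cont_diff_on k S (\<lambda>x. frechet_derivative f (at x) v)" for v
    using times_cont_diff_on_cong[OF assms(1) _ assms(3)[of v]] by simp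
  then show ?thesis
    using assms(2) by (auto simp: differentiable_def)
qed

lemma times_cont_diff_on_has_derivative:
  "times_cont_diff_on (Suc k) S f \<Longrightarrow> x \<in> S \<Longrightarrow> (f has_derivative frechet_derivative f (at x)) (at x)"
  by (simp add: frechet_derivative_works)

lemma times_cont_diff_on_Suc_lower:
  "times_cont_diff_on (Suc k) S f \<Longrightarrow> times_cont_diff_on k S f"
proof (induction k arbitrary: f)
  case 0
  then show ?case
    by (auto intro!: continuous_at_imp_continuous_on differentiable_imp_continuous_within)
next
  case (Suc k)
  have "times_cont_diff_on k S (\<lambda>x. frechet_derivative f (at x) v)" for v
    using Suc.IH[of "\<lambda>x. frechet_derivative f (at x) v"] Suc.prems by simp
  then show ?case using Suc.prems by simp
qed

lemma times_cont_diff_on_imp_continuous: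
  "times_cont_diff_on k S f \<Longrightarrow> continuous_on S f"
  by (induction k) (use times_cont_diff_on_Suc_lower in auto)

lemma times_cont_diff_on_subset:
  "times_cont_diff_on k S f \<Longrightarrow> T \<subseteq> S \<Longrightarrow> times_cont_diff_on k T f"
  by (induction k arbitrary: f) (auto intro: continuous_on_subset)

lemma times_cont_diff_on_Un:
  "open S \<Longrightarrow> open T \<Longrightarrow> times_cont_diff_on k S f \<Longrightarrow> times_cont_diff_on k T f
    \<Longrightarrow> times_cont_diff_on k (S \<union> T) f"
  by (induction k arbitrary: f) (auto intro: continuous_on_open_Un)

lemma times_cont_diff_on_const: "open S \<Longrightarrow> times_cont_diff_on k S (\<lambda>x. c)"
proof (induction k arbitrary: c)
  case (Suc k)
  show ?case
    by (rule times_cont_diff_on_SucI[OF Suc.prems has_derivative_const Suc.IH[OF Suc.prems]])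
qed simp

lemma times_cont_diff_on_linear:
  assumes "open S" and "bounded_linear f"
  shows "times_cont_diff_on k S f"
proof (cases k)
  case 0
  then show ?thesis using assms by (simp add: linear_continuous_on)
next
  case (Suc j)
  show ?thesis unfolding Suc
    by (rule times_cont_diff_on_SucI[OF assms(1), where f' = "\<lambda>x. f"])
      (use assms in \<open>auto intro: bounded_linear_imp_has_derivative times_cont_diff_on_const\<close>)
qed

lemma times_cont_diff_on_add:
  assumes "open S"
  shows "times_cont_diff_on k S f \<Longrightarrow> times_cont_diff_on k S g \<Longrightarrow> times_cont_diff_on k S (\<lambda>x. f x + g x)"
proof (induction k arbitrary: f g)
  case 0
  then show ?case by (auto intro: continuous_intros)
next
  case (Suc k)
  show ?case
  proof (rule times_cont_diff_on_SucI[OF assms])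
    show "((\<lambda>x. f x + g x) has_derivative
        (\<lambda>v. frechet_derivative f (at x) v + frechet_derivative g (at x) v)) (at x)" if "x \<in> S" for x
      using Suc.prems that by (intro has_derivative_add times_cont_diff_on_has_derivative)
    show "times_cont_diff_on k S (\<lambda>x. frechet_derivative f (at x) v + frechet_derivative g (at x) v)" for v
      using Suc.prems by (intro Suc.IH) auto
  qed
qed

lemma times_cont_diff_on_mult:
  assumes "open S"
  shows "times_cont_diff_on k S f \<Longrightarrow> times_cont_diff_on k S g \<Longrightarrow> times_cont_diff_on k S (\<lambda>x. f x * g x)"
proof (induction k arbitrary: f g)
  case 0
  then show ?case by (auto intro: continuous_intros)
next
  case (Suc k)
  show ?case
  proof (rule times_cont_diff_on_SucI[OF assms])
    show "((\<lambda>x. f x * g x) has_derivative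
        (\<lambda>v. f x * frechet_derivative g (at x) v + frechet_derivative f (at x) v * g x)) (at x)" if "x \<in> S" for x
      using Suc.prems that by (intro has_derivative_mult times_cont_diff_on_has_derivative)
    show "times_cont_diff_on k S (\<lambda>x. f x * frechet_derivative g (at x) v + frechet_derivative f (at x) v * g x)" for v
      using Suc.prems by (intro Suc.IH times_cont_diff_on_add assms times_cont_diff_on_Suc_lower[of k S f] times_cont_diff_on_Suc_lower[of k S g]) auto
  qed
qed

lemma times_cont_diff_on_sum:
  assumes "open S" and "\<And>i. i \<in> I \<Longrightarrow> times_cont_diff_on k S (f i)"
  shows "times_cont_diff_on k S (\<lambda>x. \<Sum>i\<in>I. f i x)"
  using assms(2)
  by (induction I rule: infinite_finite_induct)
    (auto intro: times_cont_diff_on_const times_cont_diff_on_add assms(1))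

text \<open>\<open>times_cont_diff_on\<close> exists for functions on \<open>real ^ 'n\<close> only,
  so the outer function \<open>G\<close> of one real variable carries no order of smoothness of its
  own. Its derivative is passed as a function \<open>G'\<close> of the point, and the regularity is
  demanded of that function.\<close>

lemma times_cont_diff_on_chain:
  assumes "open S" and "times_cont_diff_on (Suc k) S f"
    and "\<And>x. x \<in> S \<Longrightarrow> (G has_real_derivative G' x) (at (f x))"
    and "times_cont_diff_on k S G'"
  shows "times_cont_diff_on (Suc k) S (\<lambda>x. G (f x))"
proof (rule times_cont_diff_on_SucI[OF assms(1), where f' = "\<lambda>x v. frechet_derivative f (at x) v * G' x"])
  fix x assume x: "x \<in> S"
  show "((\<lambda>x. G (f x)) has_derivative (\<lambda>v. frechet_derivative f (at x) v * G' x)) (at x)"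
    using has_derivative_compose[OF times_cont_diff_on_has_derivative[OF assms(2) x]
        assms(3)[OF x, unfolded has_field_derivative_def]]
    by (simp add: mult.commute)
next
  show "times_cont_diff_on k S (\<lambda>x. frechet_derivative f (at x) v * G' x)" for v
    using assms by (intro times_cont_diff_on_mult) auto
qed

text \<open>The induction ranges over all exponents, since differentiation lowers \<open>a\<close>
  by one. Square roots and reciprocals are later written as powers so that this lemma covers
  them.\<close>

lemma times_cont_diff_on_powr:
  assumes "open S" and "\<And>x. x \<in> S \<Longrightarrow> f x > 0"
  shows "times_cont_diff_on k S f \<Longrightarrow> times_cont_diff_on k S (\<lambda>x. f x powr a)"
proof (induction k arbitrary: a)
  case 0
  have "f x \<noteq> 0" if "x \<in> S" for x using assms(2)[OF that] by simp
  then show ?case using 0 by (auto intro!: continuous_intros)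
next
  case (Suc k)
  show ?case
    by (rule times_cont_diff_on_chain[OF assms(1) Suc.prems, where G = "\<lambda>t. t powr a" and G' = "\<lambda>x. a * f x powr (a - 1)"])
      (use assms Suc in \<open>auto intro!: times_cont_diff_on_mult times_cont_diff_on_const Suc.IH
        times_cont_diff_on_Suc_lower[of k S f] has_real_derivative_powr simp del: times_cont_diff_on.simps(2)\<close>)
qed

lemma times_cont_diff_on_ln:
  assumes "open S" and "\<And>x. x \<in> S \<Longrightarrow> f x > 0" and "times_cont_diff_on k S f"
  shows "times_cont_diff_on k S (\<lambda>x. ln (f x))"
proof (cases k)
  case 0
  have "f x \<noteq> 0" if "x \<in> S" for x using assms(2)[OF that] by simp
  then show ?thesis using assms 0 by (auto intro!: continuous_intros)
next
  case (Suc j)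
  show ?thesis unfolding Suc
  proof (rule times_cont_diff_on_chain[where f = f and G = ln and G' = "\<lambda>x. f x powr - 1", OF assms(1)])
    show "times_cont_diff_on (Suc j) S f" using assms(3) unfolding Suc .
    show "(ln has_real_derivative f x powr - 1) (at (f x))" if "x \<in> S" for x
      using assms(2)[OF that] by (auto intro!: derivative_eq_intros simp: powr_minus_divide)
    show "times_cont_diff_on j S (\<lambda>x. f x powr - 1)"
      using assms Suc by (intro times_cont_diff_on_powr times_cont_diff_on_Suc_lower[of j S f]) auto
  qed
qed

lemma times_cont_diff_on_arcosh:
  assumes "open S" and "\<And>x. x \<in> S \<Longrightarrow> f x > 1" and "times_cont_diff_on k S f"
  shows "times_cont_diff_on k S (\<lambda>x. arcosh (f x))"
proof (cases k)
  case 0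
  have "continuous_on {1..} (arcosh :: real \<Rightarrow> real)" by (intro continuous_intros) auto
  moreover have "f ` S \<subseteq> {1..}" using assms(2) by (force intro: less_imp_le)
  ultimately show ?thesis using assms(3) 0 continuous_on_compose2[of "{1..}" arcosh S f] by simp
next
  case (Suc j)
  have pos: "f x * f x + - 1 > 0" if "x \<in> S" for x
    using assms(2)[OF that] less_1_mult[of "f x" "f x"] by simp
  show ?thesis unfolding Suc
  proof (rule times_cont_diff_on_chain[where f = f and G = arcosh and G' = "\<lambda>x. (f x * f x + - 1) powr - (1/2)", OF assms(1)])
    show "times_cont_diff_on (Suc j) S f" using assms(3) unfolding Suc .
    show "(arcosh has_real_derivative (f x * f x + - 1) powr - (1/2)) (at (f x))" if "x \<in> S" for x
      using assms(2)[OF that] pos[OF that]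
      by (auto intro!: derivative_eq_intros simp: powr_minus_divide powr_half_sqrt power2_eq_square)
    show "times_cont_diff_on j S (\<lambda>x. (f x * f x + - 1) powr - (1/2))"
      using assms Suc pos by (intro times_cont_diff_on_powr times_cont_diff_on_add times_cont_diff_on_mult
         times_cont_diff_on_const times_cont_diff_on_Suc_lower[of j S f]) auto
  qed
qed

section \<open>A smooth bump function built from exp (-1/t)\<close>

definition flat_exp :: "nat \<Rightarrow> real \<Rightarrow> real" where
  "flat_exp m t = (if t > 0 then exp (- (1 / t)) / t ^ m else 0)"

text \<open>A single term of the series of exp (1/t), that of order m + 2, already yields a
  quadratic bound at 0, which makes the difference quotient there tend to 0.\<close>

lemma flat_exp_bound: "\<bar>flat_exp m t\<bar> \<le> fact (m + 2) * t\<^sup>2"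
proof (cases "t > 0")
  case True
  have "(1 / t) ^ (m + 2) / fact (m + 2) \<le> exp (1 / t)"
  proof -
    have s: "(\<lambda>n. (1/t) ^ n / fact n) sums exp (1/t)"
      using exp_converges[of "1/t"] by (simp add: field_simps)
    have "(\<Sum>n\<in>{m+2}. (1/t) ^ n / fact n) \<le> exp (1/t)"
      unfolding sums_unique[OF s] using True s by (intro sum_le_suminf) (auto simp: sums_iff)
    then show ?thesis by simp
  qed
  moreover define c :: real where "c = fact (m + 2)"
  ultimately have "1 \<le> c * t ^ (m + 2) * exp (1 / t)"
    using True by (simp add: c_def[symmetric] power_divide divide_le_eq mult.commute del: fact_Suc)
  then have "exp (- (1 / t)) / t ^ m \<le> c * t\<^sup>2"
    using True by (simp add: exp_minus power_add power2_eq_square field_simps)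
  then show ?thesis using True by (simp add: flat_exp_def c_def)
qed (simp add: flat_exp_def)

text \<open>The factors t^(-m) close the family under differentiation up to linear combinations, so
  one induction over all \<open>m\<close> gives smoothness. At 0 the quadratic bound
  decides.\<close>

lemma flat_exp_has_derivative:
  "(flat_exp m has_real_derivative flat_exp (m + 2) t - of_nat m * flat_exp (m + 1) t) (at t)"
proof (cases t "0::real" rule: linorder_cases)
  case less
  have "((\<lambda>t. 0) has_real_derivative 0) (at t)" by simp
  moreover have "eventually (\<lambda>s. s \<in> {..<0}) (nhds t)" using less by (intro eventually_nhds_in_open) auto
  then have "eventually (\<lambda>s. 0 = flat_exp m s) (nhds t)"
    by eventually_elim (auto simp: flat_exp_def)
  ultimately show ?thesis using less
    by (auto simp: flat_exp_def cong: DERIV_cong_ev)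
next
  case equal
  have "((\<lambda>h. (flat_exp m h - flat_exp m 0) / h) \<longlongrightarrow> 0) (at 0)"
  proof (rule Lim_null_comparison)
    show "\<forall>\<^sub>F h in at 0. norm ((flat_exp m h - flat_exp m 0) / h) \<le> fact (m + 2) * \<bar>h\<bar>"
    proof (intro always_eventually allI)
      fix h :: real
      show "norm ((flat_exp m h - flat_exp m 0) / h) \<le> fact (m + 2) * \<bar>h\<bar>"
        using flat_exp_bound[of m h] divide_right_mono[OF flat_exp_bound[of m h], of "\<bar>h\<bar>"]
        by (cases "h = 0") (auto simp: flat_exp_def power2_eq_square abs_mult)
    qed
    show "((\<lambda>h. fact (m + 2) * \<bar>h\<bar>) \<longlongrightarrow> 0) (at (0::real))"
      by (auto intro!: tendsto_eq_intros)
  qed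
  then show ?thesis using equal by (simp add: DERIV_def flat_exp_def)
next
  case greater
  have der: "((\<lambda>t. exp (- (1 / t)) / t ^ m) has_real_derivative
      flat_exp (m + 2) t - of_nat m * flat_exp (m + 1) t) (at t)"
    using greater
    apply (cases m)
     apply (auto intro!: derivative_eq_intros simp: flat_exp_def field_simps power2_eq_square)
    by (metis Suc_pred gr0I power_Suc)
  have "eventually (\<lambda>s. s \<in> {0<..}) (nhds t)" using greater by (intro eventually_nhds_in_open) auto
  then have ev: "eventually (\<lambda>s. exp (- (1 / s)) / s ^ m = flat_exp m s) (nhds t)"
    by eventually_elim (auto simp: flat_exp_def)
  show ?thesis by (rule DERIV_cong_ev[OF refl ev refl, THEN iffD1, OF der])
qed

lemma continuous_on_flat_exp [continuous_intros]:
  "continuous_on A f \<Longrightarrow> continuous_on A (\<lambda>x. flat_exp m (f x))"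
  using continuous_on_compose2[of UNIV "flat_exp m" A f]
    DERIV_continuous_on[OF DERIV_subset[OF flat_exp_has_derivative subset_UNIV], of UNIV m]
  by auto

lemma times_cont_diff_on_flat_exp:
  assumes "open S"
  shows "times_cont_diff_on k S f \<Longrightarrow> times_cont_diff_on k S (\<lambda>x. flat_exp m (f x))"
proof (induction k arbitrary: m)
  case 0
  then show ?case by (auto intro!: continuous_intros)
next
  case (Suc k)
  show ?case
  proof (rule times_cont_diff_on_chain[where G = "flat_exp m", OF assms Suc.prems])
    show "(flat_exp m has_real_derivative flat_exp (m + 2) (f x) + (- of_nat m) * flat_exp (m + 1) (f x)) (at (f x))" for x
      using flat_exp_has_derivative[of m "f x"] by simp
    show "times_cont_diff_on k S (\<lambda>x. flat_exp (m + 2) (f x) + (- of_nat m) * flat_exp (m + 1) (f x))"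
      using assms Suc by (intro times_cont_diff_on_add times_cont_diff_on_mult times_cont_diff_on_const Suc.IH
          times_cont_diff_on_Suc_lower[of k S f])
  qed
qed

text \<open>The bump is exp (-1/(t + 2)) exp (-1/(-1 - t)) between -2 and -1. With t = ln r / k this
  interval places r between exp (-2k) and exp (-k), away from the pole but approaching it as k
  grows. Two derivatives are listed because the remainder contains second derivatives of the test
  function; the last property is smoothness in the only form in which it is available here.\<close>

lemma smooth_bump:
  obtains \<eta> \<eta>1 \<eta>2 :: "real \<Rightarrow> real"
  where "\<And>t. (\<eta> has_real_derivative \<eta>1 t) (at t)" and "\<And>t. (\<eta>1 has_real_derivative \<eta>2 t) (at t)"
    and "continuous_on UNIV \<eta>2"
    and "\<And>t. t \<notin> {-2<..<-1} \<Longrightarrow> \<eta> t = 0 \<and> \<eta>1 t = 0 \<and> \<eta>2 t = 0"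
    and "\<And>t. t \<in> {-2<..<-1} \<Longrightarrow> \<eta> t > 0"
    and "\<And>k S (f :: real ^ 'n::finite \<Rightarrow> real). open S \<Longrightarrow> times_cont_diff_on k S f
           \<Longrightarrow> times_cont_diff_on k S (\<lambda>x. \<eta> (f x))"
proof
  let ?\<eta> = "\<lambda>t. flat_exp 0 (t + 2) * flat_exp 0 (- 1 - t)"
  let ?\<eta>1 = "\<lambda>t. flat_exp 2 (t + 2) * flat_exp 0 (- 1 - t) - flat_exp 0 (t + 2) * flat_exp 2 (- 1 - t)"
  let ?\<eta>2 = "\<lambda>t. (flat_exp 4 (t + 2) - 2 * flat_exp 3 (t + 2)) * flat_exp 0 (- 1 - t)
      - 2 * flat_exp 2 (t + 2) * flat_exp 2 (- 1 - t)
      + flat_exp 0 (t + 2) * (flat_exp 4 (- 1 - t) - 2 * flat_exp 3 (- 1 - t))"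
  have d0: "(flat_exp 0 has_real_derivative flat_exp 2 t) (at t)" for t
    using flat_exp_has_derivative[of 0 t] by (simp add: numeral_2_eq_2)
  have d2: "(flat_exp 2 has_real_derivative flat_exp 4 t - 2 * flat_exp 3 t) (at t)" for t
    using flat_exp_has_derivative[of 2 t] by (simp add: eval_nat_numeral)
  note D = DERIV_chain2[OF d0] DERIV_chain2[OF d2]
  show "(?\<eta> has_real_derivative ?\<eta>1 t) (at t)" for t
    by (auto intro!: derivative_eq_intros D)
  show "(?\<eta>1 has_real_derivative ?\<eta>2 t) (at t)" for t
    by (auto intro!: derivative_eq_intros D simp: algebra_simps)
  show "continuous_on UNIV ?\<eta>2" by (intro continuous_intros)
  show "?\<eta> t = 0 \<and> ?\<eta>1 t = 0 \<and> ?\<eta>2 t = 0" if "t \<notin> {-2<..<-1}" for t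
    using that by (auto simp: flat_exp_def)
  show "?\<eta> t > 0" if "t \<in> {-2<..<-1}" for t
    using that by (auto simp: flat_exp_def)
  show "times_cont_diff_on k S (\<lambda>x. ?\<eta> (f x))"
    if S: "open S" and f: "times_cont_diff_on k S f" for k S and f :: "real ^ 'n \<Rightarrow> real"
  proof -
    have "times_cont_diff_on k S (\<lambda>x. flat_exp 0 (f x + 2) * flat_exp 0 (- 1 + (- 1) * f x))"
      by (intro times_cont_diff_on_mult times_cont_diff_on_flat_exp times_cont_diff_on_add
          times_cont_diff_on_const S f)
    then show ?thesis by simp
  qed
qed

section \<open>Divergence theorem and volume density\<close>

text \<open>Rotate \<open>v\<close> onto a multiple of a basis vector. Conjugation by an orthogonal
  matrix changes neither the determinant nor the inner product, and afterwards only one column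
  differs from the identity, which is the situation of Cramer's lemma.\<close>

lemma det_identity_plus_rank_one:
  fixes u v :: "real ^ 'n::finite"
  shows "det (\<chi> i j. (if i = j then 1 else 0) + u $ i * v $ j) = 1 + u \<bullet> v"
proof -
  let ?M = "\<lambda>u v :: real ^ 'n. (\<chi> i j. (if i = j then 1 else 0) + u $ i * v $ j) :: real ^ 'n ^ 'n"
  obtain k :: 'n where True by blast
  have ax: "det (?M u (c *\<^sub>R axis k 1)) = 1 + c * u $ k" for u c
  proof -
    have "?M u (c *\<^sub>R axis k 1) =
        (\<chi> i j. if j = k then (mat 1 *v (axis k 1 + c *\<^sub>R u)) $ i else (mat 1 :: real ^ 'n ^ 'n) $ i $ j)"
      unfolding matrix_vector_mul_lid by (auto simp: vec_eq_iff mat_def axis_def)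
    then show ?thesis
      by (simp only: cramer_lemma) (simp add: axis_def)
  qed
  obtain f :: "real ^ 'n \<Rightarrow> real ^ 'n" where f: "orthogonal_transformation f" "f v = norm v *\<^sub>R axis k 1"
    using orthogonal_transformation_exists[of v "norm v *\<^sub>R axis k 1 :: real ^ 'n"] by auto
  define Q where "Q = matrix f"
  have Q: "orthogonal_matrix Q" "\<And>x. f x = Q *v x"
    using f(1) by (auto simp: Q_def orthogonal_transformation_matrix)
  have M: "?M u v *v x = x + (v \<bullet> x) *\<^sub>R u" for u v x :: "real ^ 'n"
  proof (rule vec_eq_iff[THEN iffD2], rule allI)
    fix i
    have "(?M u v *v x) $ i = (\<Sum>j\<in>UNIV. (if i = j then x $ j else 0) + u $ i * (v $ j * x $ j))"
      unfolding matrix_vector_mult_def vec_lambda_beta by (rule sum.cong) (auto simp: distrib_right)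
    then show "(?M u v *v x) $ i = (x + (v \<bullet> x) *\<^sub>R u) $ i"
      by (simp add: sum.distrib sum_distrib_left[symmetric] inner_vec_def mult.commute)
  qed
  have eq: "Q ** ?M u v = ?M (f u) (f v) ** Q"
  proof (rule matrix_eq[THEN iffD2], rule allI)
    fix x
    have "f v \<bullet> f x = v \<bullet> x" using f(1) by (simp add: orthogonal_transformation_def)
    then show "(Q ** ?M u v) *v x = (?M (f u) (f v) ** Q) *v x"
      by (simp add: matrix_vector_mul_assoc[symmetric] M Q(2)[symmetric])
        (simp add: Q(2) matrix_vector_right_distrib matrix_vector_mult_scaleR)
  qed
  have "det Q * det (?M u v) = det (?M (f u) (f v)) * det Q"
    using arg_cong[OF eq, of det] by (simp add: det_mul)
  moreover have "det Q \<noteq> 0" using det_orthogonal_matrix[OF Q(1)] by auto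
  ultimately have "det (?M u v) = det (?M (f u) (f v))" by simp
  also have "\<dots> = 1 + f u \<bullet> f v"
    unfolding f(2) ax by (simp add: inner_axis)
  also have "\<dots> = 1 + u \<bullet> v"
    using f(1) by (simp add: orthogonal_transformation_def)
  finally show ?thesis .
qed

text \<open>By translation invariance the difference quotients have integral zero, and they converge
  dominatedly to the directional derivative.\<close>

lemma integral_directional_derivative_eq_0:
  fixes H :: "real ^ 'n::finite \<Rightarrow> real"
  assumes H: "times_cont_diff_on 1 UNIV H" and K: "compact K" "\<And>y. y \<notin> K \<Longrightarrow> H y = 0"
  shows "has_bochner_integral lborel (\<lambda>y. frechet_derivative H (at y) v) 0"
proof -
  let ?D = "\<lambda>y. frechet_derivative H (at y) v"
  have der: "(H has_derivative frechet_derivative H (at y)) (at y)" for y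
    using H times_cont_diff_on_has_derivative[of 0 UNIV H y] by simp
  have scale: "frechet_derivative H (at z) (h *\<^sub>R v) = frechet_derivative H (at z) v * h" for z h
    using linear_scale[OF has_derivative_linear[OF der[of z]]] by simp
  have contD: "continuous_on UNIV ?D" using H by simp
  have contH: "continuous_on UNIV H" using times_cont_diff_on_imp_continuous[OF H] .
  have D0: "?D y = 0" if "y \<notin> K" for y
  proof -
    have "(H has_derivative (\<lambda>_. 0)) (at y)"
      by (rule has_derivative_transform_within_open[OF has_derivative_const, where s = "- K"])
        (use K that in \<open>auto simp: compact_imp_closed open_Compl\<close>)
    then show ?thesis by (metis frechet_derivative_at)
  qed
  obtain B where B: "\<And>y. \<bar>?D y\<bar> \<le> B"
  proof -
    obtain B where "\<forall>x\<in>?D ` K. norm x \<le> B"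
      using compact_imp_bounded[OF compact_continuous_image[OF continuous_on_subset[OF contD] K(1)]]
      by (auto simp: bounded_iff)
    then have "\<bar>?D y\<bar> \<le> max B 0" for y using D0[of y] by (cases "y \<in> K") (auto intro: max.coboundedI1)
    then show ?thesis using that by blast
  qed
  obtain R where R: "\<And>y. y \<in> K \<Longrightarrow> norm y \<le> R"
    using compact_imp_bounded[OF K(1)] by (auto simp: bounded_iff)
  define t where "t n = 1 / real (Suc n)" for n
  define q where "q n y = (H (t n *\<^sub>R v + y) - H y) / t n" for n y
  have t: "t n > 0" "t n \<le> 1" for n by (auto simp: t_def)
  \<comment> \<open>The dominating function. Outside the ball of radius R + |v| both values of
    \<open>H\<close> vanish, because the step \<open>t n\<close> never exceeds 1; inside, the mean
    value theorem bounds the quotient by the bound on the derivative.\<close>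
  have qb: "norm (q n y) \<le> indicator (cball 0 (R + norm v)) y * B" for n y
  proof (cases "y \<in> cball 0 (R + norm v)")
    case True
    have "((\<lambda>s. H (s *\<^sub>R v + y)) has_real_derivative frechet_derivative H (at (s *\<^sub>R v + y)) v) (at s)" for s
    proof -
      have "((\<lambda>s. H (s *\<^sub>R v + y)) has_derivative (\<lambda>h. frechet_derivative H (at (s *\<^sub>R v + y)) (h *\<^sub>R v))) (at s)"
        by (rule has_derivative_compose[OF _ der]) (auto intro!: derivative_eq_intros)
      then show ?thesis by (simp add: has_field_derivative_def scale)
    qed
    then obtain z where "H (t n *\<^sub>R v + y) - H (0 *\<^sub>R v + y) = (t n - 0) * frechet_derivative H (at (z *\<^sub>R v + y)) v"
      using MVT2[OF t(1)[of n], of "\<lambda>s. H (s *\<^sub>R v + y)" "\<lambda>s. frechet_derivative H (at (s *\<^sub>R v + y)) v"]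
      by blast
    then have "q n y = frechet_derivative H (at (z *\<^sub>R v + y)) v"
      using t(1)[of n] by (simp add: q_def)
    then show ?thesis using B True by simp
  next
    case False
    have "y \<notin> K" using R[of y] False norm_ge_zero[of v] by (auto simp del: norm_ge_zero)
    moreover have "t n *\<^sub>R v + y \<notin> K"
    proof
      assume "t n *\<^sub>R v + y \<in> K"
      then have "norm (t n *\<^sub>R v + y) \<le> R" by (rule R)
      moreover have "norm y \<le> norm (t n *\<^sub>R v + y) + norm (t n *\<^sub>R v)"
        using norm_triangle_ineq4[of "t n *\<^sub>R v + y" "t n *\<^sub>R v"] by simp
      moreover have "norm (t n *\<^sub>R v) \<le> norm v"
        using t[of n] mult_right_mono[of "t n" 1 "norm v"] by simp
      ultimately show False using False by simp
    qed
    ultimately show ?thesis using K(2) False by (simp add: q_def)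
  qed
  have intH: "integrable lborel H"
  proof -
    have "integrable lborel (\<lambda>x. indicator K x *\<^sub>R H x)"
      using K(1) contH by (intro borel_integrable_compact) (auto intro: continuous_on_subset)
    moreover have "(\<lambda>x. indicator K x *\<^sub>R H x) = H" by (rule ext) (use K(2) in force)
    ultimately show ?thesis by simp
  qed
  have shift: "has_bochner_integral lborel (\<lambda>y. H (c + y)) (integral\<^sup>L lborel H)" for c
  proof -
    have "has_bochner_integral (distr lborel borel ((+) c)) H (integral\<^sup>L lborel H)"
      unfolding lborel_distr_plus using intH by (simp add: has_bochner_integral_iff)
    moreover have "H \<in> borel_measurable borel"
      using contH by (rule borel_measurable_continuous_onI)
    ultimately show ?thesis
      by (simp add: has_bochner_integral_iff integrable_distr_eq integral_distr)
  qed
  have q0: "has_bochner_integral lborel (q n) 0" for n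
  proof -
    have "has_bochner_integral lborel (\<lambda>y. (H (t n *\<^sub>R v + y) - H y) / t n) ((integral\<^sup>L lborel H - integral\<^sup>L lborel H) / t n)"
      using t[of n] intH
      by (intro has_bochner_integral_divide has_bochner_integral_diff shift)
        (simp_all add: has_bochner_integral_iff)
    then show ?thesis by (simp add: q_def[abs_def])
  qed
  have lim: "(\<lambda>n. q n y) \<longlonglongrightarrow> ?D y" for y
  proof -
    have "((\<lambda>s. H (s *\<^sub>R v + y)) has_derivative (\<lambda>h. frechet_derivative H (at y) (h *\<^sub>R v))) (at 0)"
      by (rule has_derivative_compose[of "\<lambda>s. s *\<^sub>R v + y" _ 0 UNIV H])
        (auto intro!: derivative_eq_intros der)
    then have "((\<lambda>s. H (s *\<^sub>R v + y)) has_real_derivative ?D y) (at 0)"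
      by (simp add: has_field_derivative_def scale)
    then have l: "((\<lambda>h. (H (h *\<^sub>R v + y) - H y) / h) \<longlongrightarrow> ?D y) (at 0)"
      by (simp add: DERIV_def)
    have "filterlim t (at 0) sequentially"
      using t LIMSEQ_inverse_real_of_nat
      by (auto simp: filterlim_at t_def[abs_def] inverse_eq_divide simp del: of_nat_Suc intro!: always_eventually)
    from filterlim_compose[OF l this] show ?thesis by (simp add: q_def)
  qed
  have meas: "?D \<in> borel_measurable lborel"
    using borel_measurable_continuous_onI[OF contD] by simp
  have bint: "integrable lborel (\<lambda>y. indicator (cball 0 (R + norm v)) y * B)"
    using borel_integrable_compact[of "cball 0 (R + norm v)" "\<lambda>_. B"] by simp
  have qm: "q n \<in> borel_measurable lborel" for n using q0[of n] by (auto simp: has_bochner_integral_iff)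
  have "integrable lborel ?D"
    by (rule integrable_dominated_convergence[where s = q, OF meas qm bint]) (use lim qb in auto)
  moreover have "(\<lambda>n. integral\<^sup>L lborel (q n)) \<longlonglongrightarrow> integral\<^sup>L lborel ?D"
    by (rule integral_dominated_convergence[where s = q, OF meas qm bint]) (use lim qb in auto)
  then have "integral\<^sup>L lborel ?D = 0"
    using q0 by (simp add: has_bochner_integral_iff LIMSEQ_const_iff)
  ultimately show ?thesis by (simp add: has_bochner_integral_iff)
qed

section \<open>Polar coordinates in the chart\<close>

text \<open>\<open>ch\<close>, \<open>sh\<close> and \<open>rad\<close> are cosh r, sinh r and r in
  the chart. \<open>ch\<close> is smooth even at the pole; only the square root in \<open>sh\<close>
  and the arcosh behind \<open>rad\<close> degenerate there, where \<open>ch\<close> equals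
  1.\<close>

definition ch :: "'n::finite mink \<Rightarrow> real ^ 'n \<Rightarrow> real" where
  "ch x0 y = - mink_inner (graph_chart y) x0"

definition sh :: "'n::finite mink \<Rightarrow> real ^ 'n \<Rightarrow> real" where
  "sh x0 y = sqrt ((ch x0 y)\<^sup>2 - 1)"

definition rad :: "'n::finite mink \<Rightarrow> real ^ 'n \<Rightarrow> real" where
  "rad x0 y = hyp_dist (graph_chart y) x0"

text \<open>With \<Theta> = (x - cosh r x0) / sinh r, the velocity sinh r x0 + cosh r \<Theta> of
  the radial geodesic equals (cosh r x - x0) / sinh r. The chart coordinate is the first component,
  and this is the first component of that vector.\<close>

definition radial_dir :: "'n::finite mink \<Rightarrow> real ^ 'n \<Rightarrow> real ^ 'n" where
  "radial_dir x0 y = (ch x0 y *\<^sub>R y - fst x0) /\<^sub>R sh x0 y"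

definition chart_radial_deriv :: "'n::finite mink \<Rightarrow> (real ^ 'n \<Rightarrow> real) \<Rightarrow> real ^ 'n \<Rightarrow> real" where
  "chart_radial_deriv x0 F y = frechet_derivative F (at y) (radial_dir x0 y)"

lemma mink_inner_simps:
  "mink_inner (x + y) z = mink_inner x z + mink_inner y z"
  "mink_inner (x - y) z = mink_inner x z - mink_inner y z"
  "mink_inner x (y + z) = mink_inner x y + mink_inner x z"
  "mink_inner x (y - z) = mink_inner x y - mink_inner x z"
  "mink_inner (c *\<^sub>R x) z = c * mink_inner x z"
  "mink_inner x (c *\<^sub>R z) = c * mink_inner x z"
  by (simp_all add: mink_inner_def inner_add_left inner_add_right inner_diff_left inner_diff_right algebra_simps)

lemma mink_inner_commute: "mink_inner x y = mink_inner y x"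
  by (simp add: mink_inner_def inner_commute mult.commute)

lemma one_plus_inner_pos: "1 + y \<bullet> y > 0" for y :: "'a::real_inner"
  by (rule add_pos_nonneg) auto

lemma mink_inner_graph_chart_self: "mink_inner (graph_chart y) (graph_chart y) = - 1"
  using one_plus_inner_pos[of y] by (simp add: mink_inner_def graph_chart_def)

lemma graph_chart_in_hyperbolic_space: "graph_chart y \<in> hyperbolic_space"
  using one_plus_inner_pos[of y] mink_inner_graph_chart_self[of y]
  by (simp add: hyperbolic_space_def graph_chart_def)

lemma graph_chart_fst:
  assumes "x \<in> hyperbolic_space"
  shows "graph_chart (fst x) = x"
proof -
  have "snd x * snd x = 1 + fst x \<bullet> fst x" "snd x > 0"
    using assms by (auto simp: hyperbolic_space_def mink_inner_def)
  then have "sqrt (1 + fst x \<bullet> fst x) = snd x"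
    by (metis abs_of_pos real_sqrt_abs2)
  then show ?thesis by (simp add: graph_chart_def)
qed

lemma fst_graph_chart [simp]: "fst (graph_chart y) = y"
  by (simp add: graph_chart_def)

locale pole =
  fixes x0 :: "'n::finite mink"
  assumes x0: "x0 \<in> hyperbolic_space"
begin

abbreviation p where "p \<equiv> fst x0"
abbreviation c where "c \<equiv> snd x0"

lemma c_sq: "c * c = 1 + p \<bullet> p" and c_pos: "c > 0"
  using x0 by (auto simp: hyperbolic_space_def mink_inner_def)

lemma mink_inner_x0: "mink_inner x0 x0 = - 1"
  using x0 by (auto simp: hyperbolic_space_def)

lemma graph_chart_neq_x0: "graph_chart y \<noteq> x0 \<longleftrightarrow> y \<noteq> p"
  using graph_chart_fst[OF x0] fst_graph_chart[of y] by metis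

lemma ch_eq: "ch x0 y = sqrt (1 + y \<bullet> y) * c - y \<bullet> p"
  by (simp add: ch_def mink_inner_def graph_chart_def)

lemma ch_p: "ch x0 p = 1"
  using graph_chart_fst[OF x0] mink_inner_x0 by (simp add: ch_def)

text \<open>The reversed Cauchy-Schwarz inequality for timelike vectors: (1 + |y|^2)(1 + |p|^2)
  exceeds (1 + y.p)^2 by |y - p|^2 plus the deficit of the ordinary Cauchy-Schwarz inequality. The
  strictness makes \<open>sh\<close> positive and arcosh differentiable off the pole.\<close>

lemma ch_gt_1:
  assumes "y \<noteq> p" shows "ch x0 y > 1"
proof -
  have "(1 + y \<bullet> p)\<^sup>2 < (1 + y \<bullet> y) * (1 + p \<bullet> p)"
  proof -
    have "(y - p) \<bullet> (y - p) > 0" using assms by simp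
    moreover have "(y \<bullet> p)\<^sup>2 \<le> (y \<bullet> y) * (p \<bullet> p)" by (rule Cauchy_Schwarz_ineq)
    ultimately show ?thesis
      by (simp add: power2_eq_square algebra_simps inner_diff_left inner_diff_right inner_commute)
  qed
  also have "\<dots> = (sqrt (1 + y \<bullet> y) * c)\<^sup>2"
  proof -
    have "c\<^sup>2 = 1 + p \<bullet> p" using c_sq by (simp only: power2_eq_square)
    then show ?thesis using one_plus_inner_pos[of y] by (simp add: power_mult_distrib)
  qed
  finally have "1 + y \<bullet> p < sqrt (1 + y \<bullet> y) * c"
    by (rule power2_less_imp_less) (use c_pos one_plus_inner_pos[of y] in simp)
  then show ?thesis by (simp add: ch_eq)
qed

lemma ch_ge_1: "ch x0 y \<ge> 1"
  using ch_gt_1[of y] ch_p by (cases "y = p") auto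

lemma rad_eq: "rad x0 y = arcosh (ch x0 y)"
  by (simp add: rad_def hyp_dist_def ch_def)

lemma cosh_rad: "cosh (rad x0 y) = ch x0 y"
  using ch_ge_1 by (simp add: rad_eq cosh_arcosh_real)

lemma sinh_rad: "sinh (rad x0 y) = sh x0 y"
  using ch_ge_1 by (simp add: rad_eq sh_def sinh_arcosh_real)

lemma rad_pos: "y \<noteq> p \<Longrightarrow> rad x0 y > 0"
  using ch_gt_1 arcosh_real_strict_mono[of 1 "ch x0 y"] by (simp add: rad_eq)

lemma sh_pos: "y \<noteq> p \<Longrightarrow> sh x0 y > 0"
  using sinh_rad[of y] rad_pos[of y] by (metis sinh_real_pos_iff)

lemma sh_sq: "sh x0 y * sh x0 y = ch x0 y * ch x0 y - 1"
  using cosh_square_eq[of "rad x0 y"] by (simp add: cosh_rad sinh_rad power2_eq_square)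

lemma polar_dir_chart:
  assumes "y \<noteq> p"
  defines "\<Theta> \<equiv> polar_dir x0 (graph_chart y)"
  shows "\<Theta> = (graph_chart y - ch x0 y *\<^sub>R x0) /\<^sub>R sh x0 y"
    and "mink_inner \<Theta> x0 = 0" and "mink_inner \<Theta> \<Theta> = 1"
proof -
  show eq: "\<Theta> = (graph_chart y - ch x0 y *\<^sub>R x0) /\<^sub>R sh x0 y"
    by (simp add: \<Theta>_def polar_dir_def cosh_rad[unfolded rad_def] sinh_rad[unfolded rad_def])
  have m: "mink_inner (graph_chart y) x0 = - ch x0 y" "mink_inner x0 (graph_chart y) = - ch x0 y"
    by (simp_all add: ch_def mink_inner_commute)
  show "mink_inner \<Theta> x0 = 0"
    by (simp add: eq mink_inner_simps mink_inner_x0 m)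
  have "mink_inner \<Theta> \<Theta> = (ch x0 y * ch x0 y - 1) / (sh x0 y * sh x0 y)"
    using sh_pos[OF assms(1)]
    by (simp add: eq mink_inner_simps mink_inner_x0 m mink_inner_graph_chart_self field_simps)
  then have "mink_inner \<Theta> \<Theta> = (sh x0 y * sh x0 y) / (sh x0 y * sh x0 y)"
    by (simp only: sh_sq)
  then show "mink_inner \<Theta> \<Theta> = 1"
    using sh_pos[OF assms(1)] by simp
qed

text \<open>The form has the value -1 along the curve, which leaves two sheets. On the lower one the
  Cauchy-Schwarz inequality would force a nonnegative product with \<open>x0\<close>, whereas this
  product is - cosh s.\<close>

lemma polar_in_hyperbolic_space:
  assumes "mink_inner \<Theta> x0 = 0" and "mink_inner \<Theta> \<Theta> = 1"
  shows "polar x0 s \<Theta> \<in> hyperbolic_space"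
proof -
  let ?z = "polar x0 s \<Theta>"
  have "mink_inner ?z ?z = sinh s * sinh s - cosh s * cosh s"
    using assms by (simp add: polar_def mink_inner_simps mink_inner_x0 mink_inner_commute[of x0 \<Theta>])
  then have zz: "mink_inner ?z ?z = - 1"
    using cosh_square_eq[of s] by (simp add: power2_eq_square)
  have zx: "mink_inner ?z x0 = - cosh s"
    using assms by (simp add: polar_def mink_inner_simps mink_inner_x0)
  have "snd ?z > 0"
  proof (rule ccontr)
    assume neg: "\<not> snd ?z > 0"
    have "(norm (fst ?z))\<^sup>2 < (snd ?z)\<^sup>2" using zz
      by (simp add: mink_inner_def power2_norm_eq_inner power2_eq_square[of "snd ?z"])
    then have "norm (fst ?z) \<le> \<bar>snd ?z\<bar>" by (metis abs_le_square_iff abs_norm_cancel less_imp_le)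
    moreover have "(norm p)\<^sup>2 < c\<^sup>2" using c_sq
      by (simp add: power2_norm_eq_inner power2_eq_square[of c])
    then have "norm p \<le> c" using c_pos by (metis less_imp_le power2_less_imp_less)
    ultimately have "norm (fst ?z) * norm p \<le> - snd ?z * c"
      using neg by (intro mult_mono) auto
    then have "\<bar>fst ?z \<bullet> p\<bar> \<le> - snd ?z * c"
      using Cauchy_Schwarz_ineq2[of "fst ?z" p] by linarith
    then have "mink_inner ?z x0 \<ge> 0" by (simp add: mink_inner_def)
    then show False using zx cosh_real_pos[of s] by simp
  qed
  then show ?thesis using zz by (simp add: hyperbolic_space_def)
qed

lemma polar_rad:
  assumes "y \<noteq> p"
  shows "polar x0 (rad x0 y) (polar_dir x0 (graph_chart y)) = graph_chart y"
  using sh_pos[OF assms] by (simp add: polar_def polar_dir_chart(1)[OF assms] cosh_rad sinh_rad)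

text \<open>\<open>u\<close> and its chart expression \<open>V\<close> are required to agree off the
  pole only: \<open>u\<close> is arbitrary at the pole, and a first radial derivative, to which the
  lemma is applied again, is known only off it. This suffices because the geodesic through the point
  avoids the pole for parameters near r.\<close>

lemma radial_deriv_chart:
  assumes "y \<noteq> p" and "\<And>z. z \<noteq> p \<Longrightarrow> u (graph_chart z) = V z" and "V differentiable (at y)"
  shows "radial_deriv x0 u (graph_chart y) = chart_radial_deriv x0 V y"
proof -
  let ?\<Theta> = "polar_dir x0 (graph_chart y)" and ?r = "rad x0 y"
  define \<gamma> where "\<gamma> s = fst (polar x0 s ?\<Theta>)" for s
  note \<Theta> = polar_dir_chart[OF assms(1)]
  have gr: "\<gamma> ?r = y" by (simp add: \<gamma>_def polar_rad[OF assms(1)])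
  have "(\<gamma> has_vector_derivative (sinh ?r *\<^sub>R p + cosh ?r *\<^sub>R fst ?\<Theta>)) (at ?r)"
    unfolding \<gamma>_def polar_def has_vector_derivative_def fst_add fst_scaleR
    by (auto intro!: derivative_eq_intros simp: algebra_simps)
  moreover have "sinh ?r *\<^sub>R p + cosh ?r *\<^sub>R fst ?\<Theta> = radial_dir x0 y"
  proof -
    have "sh x0 y *\<^sub>R (sinh ?r *\<^sub>R p + cosh ?r *\<^sub>R fst ?\<Theta>) =
        (sh x0 y * sh x0 y - ch x0 y * ch x0 y) *\<^sub>R p + ch x0 y *\<^sub>R y"
      using sh_pos[OF assms(1)] by (simp add: \<Theta>(1) cosh_rad sinh_rad scaleR_right_distrib scaleR_right_diff_distrib algebra_simps)
    also have "\<dots> = sh x0 y *\<^sub>R radial_dir x0 y"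
      using sh_pos[OF assms(1)] by (simp add: sh_sq radial_dir_def)
    finally show ?thesis using sh_pos[OF assms(1)] by simp
  qed
  ultimately have dg: "(\<gamma> has_vector_derivative radial_dir x0 y) (at ?r)" by simp
  have dV: "(V has_derivative frechet_derivative V (at y)) (at y)"
    using assms(3) by (simp add: frechet_derivative_works)
  have scale: "frechet_derivative V (at y) (h *\<^sub>R v) = frechet_derivative V (at y) v * h" for h v
    using linear_scale[OF has_derivative_linear[OF dV]] by simp
  have "((\<lambda>s. V (\<gamma> s)) has_derivative (\<lambda>h. frechet_derivative V (at y) (h *\<^sub>R radial_dir x0 y))) (at ?r)"
    by (rule has_derivative_compose[OF dg[unfolded has_vector_derivative_def]]) (simp add: gr dV)
  then have dVg: "((\<lambda>s. V (\<gamma> s)) has_real_derivative chart_radial_deriv x0 V y) (at ?r)"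
    by (simp add: has_field_derivative_def chart_radial_deriv_def scale)
  have "isCont \<gamma> ?r"
    using dg has_vector_derivative_continuous by blast
  then have "(\<gamma> \<longlongrightarrow> \<gamma> ?r) (nhds ?r)"
    by (simp add: isCont_def tendsto_at_iff_tendsto_nhds)
  then have "\<forall>\<^sub>F s in nhds ?r. \<gamma> s \<in> - {p}"
    by (rule topological_tendstoD) (use assms(1) gr in auto)
  then have "\<forall>\<^sub>F s in nhds ?r. u (polar x0 s ?\<Theta>) = V (\<gamma> s)"
  proof eventually_elim
    case (elim s)
    have "graph_chart (\<gamma> s) = polar x0 s ?\<Theta>"
      unfolding \<gamma>_def by (rule graph_chart_fst[OF polar_in_hyperbolic_space[OF \<Theta>(2,3)]])
    then show ?case using assms(2)[of "\<gamma> s"] elim by simp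
  qed
  then have "((\<lambda>s. u (polar x0 s ?\<Theta>)) has_real_derivative chart_radial_deriv x0 V y) (at ?r)"
    by (rule DERIV_cong_ev[OF refl _ refl, THEN iffD2, OF _ dVg])
  then show ?thesis
    by (simp add: radial_deriv_def rad_def DERIV_imp_deriv)
qed

lemma sq_norm_radial_grad_chart:
  assumes "y \<noteq> p"
  shows "sq_norm (radial_grad x0 u (graph_chart y)) = (radial_deriv x0 u (graph_chart y))\<^sup>2"
proof -
  let ?\<Theta> = "polar_dir x0 (graph_chart y)"
  have "mink_inner (radial_field x0 (graph_chart y)) (radial_field x0 (graph_chart y)) =
      ch x0 y * ch x0 y - sh x0 y * sh x0 y"
    using polar_dir_chart(2,3)[OF assms]
    by (simp add: radial_field_def mink_inner_simps mink_inner_x0 mink_inner_commute[of x0 ?\<Theta>]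
        cosh_rad[unfolded rad_def] sinh_rad[unfolded rad_def])
  then show ?thesis
    by (simp add: sq_norm_def radial_grad_def mink_inner_simps sh_sq power2_eq_square)
qed

section \<open>The radial field acting on functions of the distance\<close>

lemma ch_has_derivative:
  "(ch x0 has_derivative (\<lambda>v. c * (y \<bullet> v) / sqrt (1 + y \<bullet> y) - p \<bullet> v)) (at y)"
  unfolding ch_eq[abs_def] using one_plus_inner_pos[of y]
  by (auto intro!: derivative_eq_intros simp: inner_commute field_simps)

text \<open>This is d/dr cosh r = sinh r with denominators cleared: \<open>sh\<close> times
  \<open>radial_dir\<close> is inserted into the derivative of \<open>ch\<close>. In terms of s =
  sqrt (1 + |y|^2) and a = y.p it is a rational identity.\<close>

lemma ch_derivative_radial:
  "c * (y \<bullet> (ch x0 y *\<^sub>R y - p)) / sqrt (1 + y \<bullet> y) - p \<bullet> (ch x0 y *\<^sub>R y - p) = sh x0 y * sh x0 y"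
proof -
  define s a where "s = sqrt (1 + y \<bullet> y)" and "a = y \<bullet> p"
  have s: "s > 0" "y \<bullet> y = s * s - 1" using one_plus_inner_pos[of y] by (auto simp: s_def)
  have p: "p \<bullet> p = c * c - 1" using c_sq by simp
  have t: "ch x0 y = s * c - a" by (simp add: ch_eq s_def a_def)
  have "c * (y \<bullet> (ch x0 y *\<^sub>R y - p)) / s - p \<bullet> (ch x0 y *\<^sub>R y - p)
      = c * ((s * c - a) * (s * s - 1) - a) / s - ((s * c - a) * a - (c * c - 1))"
    by (simp add: inner_diff_right s(2) p t a_def[symmetric] inner_commute[of p y])
  also have "\<dots> = (s * c - a) * (s * c - a) - 1"
    using s(1) by (simp add: field_simps)
  finally show ?thesis by (simp add: sh_sq t s_def)
qed

lemma rad_has_derivative: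
  assumes "y \<noteq> p"
  shows "(rad x0 has_derivative (\<lambda>v. (c * (y \<bullet> v) / sqrt (1 + y \<bullet> y) - p \<bullet> v) / sh x0 y)) (at y)"
proof -
  have "(arcosh has_real_derivative (1 / sh x0 y)) (at (ch x0 y))"
    using arcosh_real_has_field_derivative[OF ch_gt_1[OF assms]] by (simp add: sh_def)
  from has_derivative_compose[OF ch_has_derivative this[unfolded has_field_derivative_def]]
  show ?thesis unfolding rad_eq[abs_def] by simp
qed

lemma chart_radial_deriv_eqI:
  "(F has_derivative D) (at y) \<Longrightarrow> chart_radial_deriv x0 F y = D (radial_dir x0 y)"
  using frechet_derivative_at by (fastforce simp: chart_radial_deriv_def)

text \<open>By the chain rule everything reduces to the fact that r itself has radial derivative
  1.\<close>

lemma chart_radial_deriv_compose_rad: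
  assumes "y \<noteq> p" and "(G has_real_derivative G') (at (rad x0 y))"
  shows "(\<lambda>z. G (rad x0 z)) differentiable (at y)"
    and "chart_radial_deriv x0 (\<lambda>z. G (rad x0 z)) y = G'"
proof -
  note d = has_derivative_compose[OF rad_has_derivative[OF assms(1)] assms(2)[unfolded has_field_derivative_def]]
  show "(\<lambda>z. G (rad x0 z)) differentiable (at y)" using d by (auto simp: differentiable_def)
  define w where "w = ch x0 y *\<^sub>R y - p"
  have "chart_radial_deriv x0 (\<lambda>z. G (rad x0 z)) y =
     G' * ((c * (y \<bullet> (w /\<^sub>R sh x0 y)) / sqrt (1 + y \<bullet> y) - p \<bullet> (w /\<^sub>R sh x0 y)) / sh x0 y)"
    unfolding w_def using chart_radial_deriv_eqI[OF d] by (simp add: radial_dir_def)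
  also have "(c * (y \<bullet> (w /\<^sub>R sh x0 y)) / sqrt (1 + y \<bullet> y) - p \<bullet> (w /\<^sub>R sh x0 y)) / sh x0 y
     = (c * (y \<bullet> w) / sqrt (1 + y \<bullet> y) - p \<bullet> w) / (sh x0 y * sh x0 y)"
    by (simp add: divide_inverse algebra_simps)
  also have "\<dots> = 1" using ch_derivative_radial[of y] sh_pos[OF assms(1)] by (simp add: w_def)
  finally show "chart_radial_deriv x0 (\<lambda>z. G (rad x0 z)) y = G'" by simp
qed

lemma chart_radial_deriv_mult:
  assumes "F differentiable (at y)" and "G differentiable (at y)"
  shows "chart_radial_deriv x0 (\<lambda>z. F z * G z) y =
    F y * chart_radial_deriv x0 G y + chart_radial_deriv x0 F y * G y"
  using chart_radial_deriv_eqI[OF has_derivative_mult[OF assms[unfolded frechet_derivative_works]]]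
  by (simp add: chart_radial_deriv_def)

section \<open>Smoothness of the chart quantities off the pole\<close>

lemma times_cont_diff_on_sqrt_one_plus:
  "times_cont_diff_on k UNIV (\<lambda>y :: real ^ 'n. (1 + y \<bullet> y) powr a)"
proof -
  have "times_cont_diff_on k UNIV (\<lambda>y :: real ^ 'n. (1 + (\<Sum>i\<in>UNIV. y $ i * y $ i)) powr a)"
    using one_plus_inner_pos[where 'a = "real ^ 'n"]
    by (intro times_cont_diff_on_powr times_cont_diff_on_add times_cont_diff_on_const times_cont_diff_on_sum
        times_cont_diff_on_mult times_cont_diff_on_linear bounded_linear_vec_nth open_UNIV)
      (simp add: inner_vec_def)
  then show ?thesis by (simp add: inner_vec_def)
qed

lemma times_cont_diff_on_ch: "times_cont_diff_on k UNIV (ch x0)"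
proof -
  have "times_cont_diff_on k UNIV (\<lambda>y. (1 + y \<bullet> y) powr (1 / 2) * c + y \<bullet> (- p))"
    by (intro times_cont_diff_on_add times_cont_diff_on_mult times_cont_diff_on_sqrt_one_plus times_cont_diff_on_const
        times_cont_diff_on_linear open_UNIV bounded_linear_inner_left)
  then show ?thesis
    using one_plus_inner_pos[where 'a = "real ^ 'n"] by (simp add: ch_eq[abs_def] powr_half_sqrt less_imp_le)
qed

lemma open_punctured: "open (- {p})" by auto

lemma times_cont_diff_on_rad: "times_cont_diff_on k (- {p}) (rad x0)"
  unfolding rad_eq[abs_def]
  by (intro times_cont_diff_on_arcosh open_punctured times_cont_diff_on_subset[OF times_cont_diff_on_ch])
    (auto intro: ch_gt_1)

lemma times_cont_diff_on_sh_powr: "times_cont_diff_on k (- {p}) (\<lambda>y. sh x0 y powr a)"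
proof -
  have gt: "ch x0 y * ch x0 y + - 1 > 0" if "y \<in> - {p}" for y
    using less_1_mult[OF ch_gt_1 ch_gt_1, of y y] that by simp
  have "times_cont_diff_on k (- {p}) (\<lambda>y. (ch x0 y * ch x0 y + - 1) powr (a / 2))"
    by (intro times_cont_diff_on_powr times_cont_diff_on_add times_cont_diff_on_mult times_cont_diff_on_const open_punctured
        times_cont_diff_on_subset[OF times_cont_diff_on_ch] gt) auto
  then show ?thesis
  proof (rule times_cont_diff_on_cong[OF open_punctured, rotated])
    fix y assume "y \<in> - {p}"
    then show "(ch x0 y * ch x0 y + - 1) powr (a / 2) = sh x0 y powr a"
      using gt[of y] by (simp add: sh_def powr_half_sqrt[symmetric] powr_powr power2_eq_square)
  qed
qed

lemma times_cont_diff_on_radial_dir: "times_cont_diff_on k (- {p}) (\<lambda>y. radial_dir x0 y $ i)"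
proof -
  have "times_cont_diff_on k (- {p}) (\<lambda>y. sh x0 y powr - 1 * (ch x0 y * y $ i + - p $ i))"
    by (intro times_cont_diff_on_add times_cont_diff_on_mult times_cont_diff_on_const open_punctured
        times_cont_diff_on_subset[OF times_cont_diff_on_ch] times_cont_diff_on_sh_powr
        times_cont_diff_on_linear bounded_linear_vec_nth) auto
  then show ?thesis
  proof (rule times_cont_diff_on_cong[OF open_punctured, rotated])
    fix y assume "y \<in> - {p}"
    then have "sh x0 y > 0" using sh_pos by simp
    then show "sh x0 y powr - 1 * (ch x0 y * y $ i + - p $ i) = radial_dir x0 y $ i"
      by (simp add: radial_dir_def powr_minus divide_inverse)
  qed
qed

text \<open>The definition of \<open>times_cont_diff_on\<close> controls derivatives in fixed
  directions, whereas the radial direction moves with the point; the coordinate form reduces the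
  second case to the first.\<close>

lemma chart_radial_deriv_sum:
  assumes "F differentiable (at y)"
  shows "chart_radial_deriv x0 F y = (\<Sum>i\<in>UNIV. radial_dir x0 y $ i * frechet_derivative F (at y) (axis i 1))"
proof -
  have lin: "linear (frechet_derivative F (at y))"
    using assms by (rule linear_frechet_derivative)
  have "frechet_derivative F (at y) v = (\<Sum>i\<in>UNIV. v $ i * frechet_derivative F (at y) (axis i 1))" for v
  proof -
    have "frechet_derivative F (at y) v = frechet_derivative F (at y) (\<Sum>i\<in>UNIV. v $ i *\<^sub>R axis i 1)"
      by (simp add: basis_expansion flip: scalar_mult_eq_scaleR)
    also have "\<dots> = (\<Sum>i\<in>UNIV. v $ i * frechet_derivative F (at y) (axis i 1))"
      by (simp add: linear_sum[OF lin] linear_scale[OF lin])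
    finally show ?thesis .
  qed
  then show ?thesis unfolding chart_radial_deriv_def .
qed

lemma times_cont_diff_on_chart_radial_deriv:
  assumes "times_cont_diff_on (Suc k) (- {p}) F"
  shows "times_cont_diff_on k (- {p}) (chart_radial_deriv x0 F)"
proof -
  have "times_cont_diff_on k (- {p})
      (\<lambda>y. \<Sum>i\<in>UNIV. radial_dir x0 y $ i * frechet_derivative F (at y) (axis i 1))"
    using assms by (intro times_cont_diff_on_sum times_cont_diff_on_mult times_cont_diff_on_radial_dir open_punctured) auto
  then show ?thesis
    by (rule times_cont_diff_on_cong[OF open_punctured, rotated])
      (use assms in \<open>auto simp: chart_radial_deriv_sum\<close>)
qed

end

section \<open>Integration on hyperbolic space\<close>

text \<open>The last Minkowski coordinate enters with a minus sign, so the metric is the identity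
  minus y y^T / (1 + |y|^2), a perturbation of rank one.\<close>

lemma sqrt_det_chart_metric: "sqrt (det (chart_metric y)) = 1 / sqrt (1 + y \<bullet> y)"
proof -
  let ?s = "sqrt (1 + y \<bullet> y)"
  have s: "?s > 0" "?s * ?s = 1 + y \<bullet> y" using one_plus_inner_pos[of y] by auto
  have "chart_metric y = (\<chi> i j. (if i = j then 1 else 0) + (- (1 / ?s) *\<^sub>R y) $ i * ((1 / ?s) *\<^sub>R y) $ j)"
    by (simp add: chart_metric_def vec_eq_iff mink_inner_def chart_frame_def inner_axis_axis)
  then have "det (chart_metric y) = 1 + (- (1 / ?s) *\<^sub>R y) \<bullet> ((1 / ?s) *\<^sub>R y)"
    by (simp only: det_identity_plus_rank_one)
  also have "\<dots> = 1 - (y \<bullet> y) / (?s * ?s)" by simp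
  also have "\<dots> = (1 / ?s) * (1 / ?s)"
    using one_plus_inner_pos[of y] unfolding times_divide_times_eq s(2) by (simp add: field_simps)
  finally show ?thesis using s by (simp add: real_sqrt_divide)
qed

lemma measurable_graph_chart:
  "(graph_chart :: real ^ 'n::finite \<Rightarrow> 'n mink) \<in> lborel \<rightarrow>\<^sub>M restrict_space borel hyperbolic_space"
proof (rule measurable_restrict_space2)
  have "continuous_on UNIV (graph_chart :: real ^ 'n \<Rightarrow> 'n mink)"
    unfolding graph_chart_def[abs_def] by (intro continuous_intros)
  then show "(graph_chart :: real ^ 'n \<Rightarrow> 'n mink) \<in> borel_measurable lborel"
    by (simp add: borel_measurable_continuous_onI)
qed (simp add: graph_chart_in_hyperbolic_space)

context pole
begin

text \<open>The complement of \<open>K\<close> is an open neighbourhood of the pole on which the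
  extension vanishes identically. Together with the punctured space it covers everything, and
  smoothness is local.\<close>

lemma times_cont_diff_on_extend_zero:
  fixes F :: "real ^ 'n \<Rightarrow> real"
  assumes "times_cont_diff_on k (- {p}) F" and "compact K" and "p \<notin> K"
    and "\<And>y. y \<noteq> p \<Longrightarrow> y \<notin> K \<Longrightarrow> F y = 0"
  shows "times_cont_diff_on k UNIV (\<lambda>y. if y = p then 0 else F y)"
proof -
  have o: "open (- K)" using assms(2) by (simp add: compact_imp_closed open_Compl)
  have "times_cont_diff_on k (- {p} \<union> - K) (\<lambda>y. if y = p then 0 else F y)"
  proof (rule times_cont_diff_on_Un[OF open_punctured o])
    show "times_cont_diff_on k (- {p}) (\<lambda>y. if y = p then 0 else F y)"
      by (rule times_cont_diff_on_cong[OF open_punctured _ assms(1)]) auto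
    show "times_cont_diff_on k (- K) (\<lambda>y. if y = p then 0 else F y)"
      by (rule times_cont_diff_on_cong[OF o _ times_cont_diff_on_const[OF o, of k 0]]) (use assms(4) in auto)
  qed
  moreover have "- {p} \<union> - K = UNIV" using assms(3) by auto
  ultimately show ?thesis by simp
qed

text \<open>Transfer of integrals to flat space. \<open>f\<close> is free at \<open>x0\<close>,
  since a point is a null set and a change at one point preserves measurability; the value 0 at the
  pole makes the flat integrand continuous everywhere. Integrability is stated separately because
  later arguments on flat space use it directly.\<close>

lemma has_bochner_integral_hyp_volume:
  fixes F :: "real ^ 'n \<Rightarrow> real"
  assumes F: "continuous_on (- {p}) F" and K: "compact K" "p \<notin> K"
    and F0: "\<And>y. y \<noteq> p \<Longrightarrow> y \<notin> K \<Longrightarrow> F y = 0"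
    and f: "\<And>y. y \<noteq> p \<Longrightarrow> f (graph_chart y) = F y"
  shows "integrable lborel (\<lambda>y. (if y = p then 0 else F y) / sqrt (1 + y \<bullet> y))"
    and "has_bochner_integral hyp_volume f (\<integral>y. (if y = p then 0 else F y) / sqrt (1 + y \<bullet> y) \<partial>lborel)"
proof -
  let ?F = "\<lambda>y. if y = p then 0 else F y"
  let ?G = "\<lambda>y. ?F y / sqrt (1 + y \<bullet> y)"
  have cont: "continuous_on UNIV ?F"
    using times_cont_diff_on_extend_zero[of 0 F K] assms by simp
  have s: "sqrt (1 + y \<bullet> y) \<noteq> 0" for y :: "real ^ 'n" using one_plus_inner_pos[of y] by auto
  have contG: "continuous_on UNIV ?G"
    using s by (intro continuous_on_divide cont continuous_intros) auto
  have "integrable lborel (\<lambda>y. indicator K y *\<^sub>R ?G y)"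
    using K(1) contG by (intro borel_integrable_compact) (auto intro: continuous_on_subset)
  moreover have "(\<lambda>y. indicator K y *\<^sub>R ?G y) = ?G" by (rule ext) (use F0 in \<open>auto simp: indicator_def\<close>)
  ultimately show int: "integrable lborel ?G" by simp
  have measF: "?F \<in> borel_measurable borel" using cont by (rule borel_measurable_continuous_onI)
  have meas: "f \<in> borel_measurable (restrict_space borel hyperbolic_space)"
  proof (subst measurable_cong)
    show "f x = (if x = x0 then f x0 else ?F (fst x))" if "x \<in> space (restrict_space borel hyperbolic_space)" for x
    proof -
      have gx: "graph_chart (fst x) = x" using that by (intro graph_chart_fst) (simp add: space_restrict_space)
      then have "x \<noteq> x0 \<Longrightarrow> fst x \<noteq> p" using graph_chart_neq_x0[of "fst x"] by auto
      then show ?thesis using f[of "fst x"] gx by auto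
    qed
    show "(\<lambda>x. if x = x0 then f x0 else ?F (fst x)) \<in> borel_measurable (restrict_space borel hyperbolic_space)"
    proof (rule measurable_restrict_space1)
      have "(fst :: 'n mink \<Rightarrow> _) \<in> borel_measurable borel"
        by (intro borel_measurable_continuous_onI continuous_intros)
      from measurable_compose[OF this measF]
      have m: "(\<lambda>x :: 'n mink. ?F (fst x)) \<in> borel_measurable borel" .
      have "{x \<in> space borel. x = x0} = {x0}" by auto
      then show "(\<lambda>x. if x = x0 then f x0 else ?F (fst x)) \<in> borel_measurable borel"
        by (intro measurable_If[OF measurable_const m]) (simp_all only: borel_singleton, auto)
    qed
  qed
  have ae: "AE y in lborel. (1 / sqrt (1 + y \<bullet> y)) * f (graph_chart y) = ?G y"
    using AE_lborel_singleton[of p] by eventually_elim (simp add: f)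
  have mfg: "(\<lambda>y. f (graph_chart y)) \<in> borel_measurable lborel"
    using measurable_compose[OF measurable_graph_chart meas] .
  have ms: "(\<lambda>y :: real ^ 'n. 1 / sqrt (1 + y \<bullet> y)) \<in> borel_measurable lborel"
  proof -
    have "continuous_on UNIV (\<lambda>y :: real ^ 'n. 1 / sqrt (1 + y \<bullet> y))"
      using s by (intro continuous_on_divide continuous_intros) auto
    then show ?thesis by (simp add: borel_measurable_continuous_onI)
  qed
  have "integrable lborel (\<lambda>y. (1 / sqrt (1 + y \<bullet> y)) * f (graph_chart y))"
    by (rule integrable_cong_AE_imp[OF int borel_measurable_times[OF ms mfg]])
      (use ae in eventually_elim, simp only:)
  moreover have "(\<integral>y. (1 / sqrt (1 + y \<bullet> y)) * f (graph_chart y) \<partial>lborel) = integral\<^sup>L lborel ?G"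
    by (rule integral_cong_AE[OF borel_measurable_times[OF ms mfg] borel_measurable_integrable[OF int] ae])
  ultimately have "has_bochner_integral lborel (\<lambda>y. (1 / sqrt (1 + y \<bullet> y)) *\<^sub>R f (graph_chart y)) (integral\<^sup>L lborel ?G)"
    by (simp add: has_bochner_integral_iff)
  then have "has_bochner_integral (density lborel (\<lambda>y. ennreal (1 / sqrt (1 + y \<bullet> y)))) (\<lambda>y. f (graph_chart y)) (integral\<^sup>L lborel ?G)"
    using one_plus_inner_pos[where 'a = "real ^ 'n"]
    by (intro has_bochner_integral_density mfg ms) (auto intro: less_imp_le)
  then show "has_bochner_integral hyp_volume f (integral\<^sup>L lborel ?G)"
    unfolding hyp_volume_def sqrt_det_chart_metric
    by (intro has_bochner_integral_distr meas) (use measurable_graph_chart in auto)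
qed

lemma hyp_volume_integrable:
  fixes F :: "real ^ 'n \<Rightarrow> real" and I :: "'n mink \<Rightarrow> real"
  assumes "continuous_on (- {p}) F" and "compact K" and "p \<notin> K"
    and "\<And>y. y \<noteq> p \<Longrightarrow> y \<notin> K \<Longrightarrow> F y = 0" and "\<And>y. y \<noteq> p \<Longrightarrow> I (graph_chart y) = F y"
  shows "integrable hyp_volume I"
  using has_bochner_integral_hyp_volume(2)[OF assms] by (simp add: has_bochner_integral_iff)

text \<open>In the chart the divergence of \<open>F \<partial>\<^sub>r\<close> is that of the vector field
  \<open>F (ch y - p) / (sh sqrt (1 + y \<bullet> y))\<close> on flat space.\<close>

lemma sum_derivative_radial_dir:
  assumes "y \<noteq> p"
  defines "s \<equiv> sqrt (1 + y \<bullet> y)"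
  obtains W where "\<And>i. ((\<lambda>z. radial_dir x0 z $ i / sqrt (1 + z \<bullet> z)) has_derivative W i) (at y)"
    and "(\<Sum>i\<in>UNIV. W i (axis i 1)) = (real CARD('n) - 1) * coth (rad x0 y) / s"
proof -
  have s: "s > 0" "s * s = 1 + y \<bullet> y" using one_plus_inner_pos[of y] by (auto simp: s_def)
  have shp: "sh x0 y > 0" using sh_pos[OF assms(1)] .
  define A where "A v = c * (y \<bullet> v) / s - p \<bullet> v" for v
  define Z where "Z = ch x0 y *\<^sub>R y - p"
  define m where "m = sh x0 y * s"
  have m: "m > 0" using shp s by (simp add: m_def)
  have dch: "(ch x0 has_derivative A) (at y)"
    unfolding A_def s_def by (rule ch_has_derivative)
  have ds: "((\<lambda>z. sqrt (1 + z \<bullet> z)) has_derivative (\<lambda>v. (y \<bullet> v) / s)) (at y)"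
    unfolding s_def using one_plus_inner_pos[of y]
    by (auto intro!: derivative_eq_intros simp: inner_commute field_simps)
  have dsh: "(sh x0 has_derivative (\<lambda>v. ch x0 y * A v / sh x0 y)) (at y)"
  proof -
    have "(ch x0 y)\<^sup>2 - 1 > 0" using shp by (simp add: sh_def)
    then have "((\<lambda>z. sqrt ((ch x0 z)\<^sup>2 - 1)) has_derivative (\<lambda>v. ch x0 y * A v / sqrt ((ch x0 y)\<^sup>2 - 1))) (at y)"
      by (auto intro!: derivative_eq_intros dch simp: field_simps)
    then show ?thesis by (simp add: sh_def[abs_def])
  qed
  let ?W = "\<lambda>i v. (A v * y $ i + ch x0 y * v $ i) / m
      - Z $ i / m * (ch x0 y * A v / (sh x0 y * sh x0 y) + (y \<bullet> v) / (s * s))"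
  show thesis
  proof
    fix i
    have "((\<lambda>z. (ch x0 z * z $ i - p $ i) / (sh x0 z * sqrt (1 + z \<bullet> z))) has_derivative ?W i) (at y)"
    proof (rule has_derivative_eq_rhs)
      have num: "((\<lambda>z. ch x0 z * z $ i - p $ i) has_derivative (\<lambda>v. ch x0 y * v $ i + A v * y $ i - 0)) (at y)"
        by (intro has_derivative_diff has_derivative_mult dch has_derivative_const
            bounded_linear_imp_has_derivative bounded_linear_vec_nth)
      show "((\<lambda>z. (ch x0 z * z $ i - p $ i) / (sh x0 z * sqrt (1 + z \<bullet> z))) has_derivative
        (\<lambda>v. ((ch x0 y * v $ i + A v * y $ i - 0) * (sh x0 y * s) - (ch x0 y * y $ i - p $ i) *
            (sh x0 y * ((y \<bullet> v) / s) + ch x0 y * A v / sh x0 y * s)) / ((sh x0 y * s) * (sh x0 y * s)))) (at y)"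
        unfolding s_def
        by (rule has_derivative_divide'[OF num has_derivative_mult[OF dsh ds[unfolded s_def]]])
          (use shp s(1) in \<open>simp add: s_def\<close>)
      show "(\<lambda>v. ((ch x0 y * v $ i + A v * y $ i - 0) * (sh x0 y * s) - (ch x0 y * y $ i - p $ i) *
            (sh x0 y * ((y \<bullet> v) / s) + ch x0 y * A v / sh x0 y * s)) / ((sh x0 y * s) * (sh x0 y * s))) = ?W i"
        by (rule ext) (use shp s(1) in \<open>simp add: m_def Z_def field_simps\<close>)
    qed
    then show "((\<lambda>z. radial_dir x0 z $ i / sqrt (1 + z \<bullet> z)) has_derivative ?W i) (at y)"
      by (simp add: radial_dir_def divide_inverse mult_ac)
    have yy: "(\<Sum>i\<in>UNIV. y $ i * y $ i) = y \<bullet> y" and py: "(\<Sum>i\<in>UNIV. p $ i * y $ i) = p \<bullet> y"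
      by (simp_all add: inner_vec_def)
    have Aax: "A (axis i 1) = c * y $ i / s - p $ i" for i
      by (simp add: A_def inner_axis)
    have S1: "(\<Sum>i\<in>UNIV. A (axis i 1) * y $ i) = c * (y \<bullet> y) / s - p \<bullet> y"
      by (simp add: Aax left_diff_distrib sum_subtractf yy[symmetric] py[symmetric] sum_distrib_left sum_divide_distrib mult.assoc)
    have S2: "(\<Sum>i\<in>UNIV. Z $ i * A (axis i 1)) = sh x0 y * sh x0 y"
    proof -
      have "(\<Sum>i\<in>UNIV. Z $ i * A (axis i 1)) = A Z"
        unfolding Aax
        by (simp add: A_def inner_vec_def right_diff_distrib sum_subtractf sum_distrib_left sum_divide_distrib mult_ac)
      then show ?thesis using ch_derivative_radial[of y] by (simp add: A_def Z_def s_def)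
    qed
    have S3: "(\<Sum>i\<in>UNIV. Z $ i * y $ i) = ch x0 y * (y \<bullet> y) - p \<bullet> y"
      by (simp add: Z_def left_diff_distrib sum_subtractf yy[symmetric] py[symmetric] sum_distrib_left mult.assoc)
    have "(\<Sum>i\<in>UNIV. ?W i (axis i 1)) =
        ((\<Sum>i\<in>UNIV. A (axis i 1) * y $ i) + real CARD('n) * ch x0 y
         - (ch x0 y / (sh x0 y * sh x0 y) * (\<Sum>i\<in>UNIV. Z $ i * A (axis i 1))
            + (\<Sum>i\<in>UNIV. Z $ i * y $ i) / (s * s))) / m"
      by (simp add: inner_axis sum_subtractf sum.distrib sum_divide_distrib sum_distrib_left
          add_divide_distrib diff_divide_distrib distrib_left mult_ac)
    also have "\<dots> = (c * (y \<bullet> y) / s - p \<bullet> y + real CARD('n) * ch x0 y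
        - (ch x0 y + (ch x0 y * (y \<bullet> y) - p \<bullet> y) / (s * s))) / m"
      unfolding S1 S2 S3 using shp by simp
    \<comment> \<open>The contribution of the derivative of \<open>ch\<close> cancels that of the
      density through this identity, and the derivative of \<open>sh\<close> cancels one of the N
      copies of \<open>ch\<close>; what remains is (N - 1) ch / (sh s).\<close>
    also have "c * (y \<bullet> y) / s - p \<bullet> y = (ch x0 y * (y \<bullet> y) - p \<bullet> y) / (s * s)"
    proof -
      define a where "a = p \<bullet> y"
      have yy': "y \<bullet> y = s * s - 1" using s by simp
      have t: "ch x0 y = s * c - a" by (simp add: ch_eq s_def a_def inner_commute)
      then show ?thesis unfolding a_def[symmetric] yy' t using s(1) by (simp add: field_simps)
    qed
    finally show "(\<Sum>i\<in>UNIV. ?W i (axis i 1)) = (real CARD('n) - 1) * coth (rad x0 y) / s"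
      by (simp add: coth_def cosh_rad sinh_rad m_def left_diff_distrib)
  qed
qed

lemma chart_radial_deriv_eq_0:
  fixes F :: "real ^ 'n \<Rightarrow> real"
  assumes "compact K" and "\<And>z. z \<noteq> p \<Longrightarrow> z \<notin> K \<Longrightarrow> F z = 0" and "y \<noteq> p" and "y \<notin> K"
  shows "chart_radial_deriv x0 F y = 0"
proof -
  have "(F has_derivative (\<lambda>_. 0)) (at y)"
    by (rule has_derivative_transform_within_open[OF has_derivative_const, where s = "- K \<inter> - {p}"])
      (use assms in \<open>auto intro!: open_Int simp: compact_imp_closed open_Compl\<close>)
  then show ?thesis by (rule chart_radial_deriv_eqI)
qed

text \<open>The components of the field times the volume density are C^1 on all of flat space once
  extended by zero, so each partial derivative integrates to zero. Their sum is the density times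
  the Riemannian divergence, and \<open>hyp_volume\<close> absorbs the density.\<close>

lemma hyp_volume_radial_divergence:
  fixes F :: "real ^ 'n \<Rightarrow> real"
  assumes F: "times_cont_diff_on 1 (- {p}) F" and K: "compact K" "p \<notin> K"
    and F0: "\<And>y. y \<noteq> p \<Longrightarrow> y \<notin> K \<Longrightarrow> F y = 0"
    and f: "\<And>y. y \<noteq> p \<Longrightarrow> f (graph_chart y) =
      chart_radial_deriv x0 F y + (real CARD('n) - 1) * coth (rad x0 y) * F y"
  shows "has_bochner_integral hyp_volume f 0"
proof -
  let ?s = "\<lambda>y :: real ^ 'n. sqrt (1 + y \<bullet> y)"
  let ?E = "\<lambda>y. chart_radial_deriv x0 F y + (real CARD('n) - 1) * coth (rad x0 y) * F y"
  define H where "H i y = (if y = p then 0 else F y * (radial_dir x0 y $ i * (1 + y \<bullet> y) powr (- (1 / 2))))" for i y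
  have spw: "(1 + y \<bullet> y) powr (- (1 / 2)) = 1 / ?s y" for y :: "real ^ 'n"
    using one_plus_inner_pos[of y] by (simp add: powr_minus_divide powr_half_sqrt less_imp_le)
  have tcdH: "times_cont_diff_on 1 UNIV (H i)" for i
    unfolding H_def[abs_def]
  proof (rule times_cont_diff_on_extend_zero[OF _ K])
    show "times_cont_diff_on 1 (- {p}) (\<lambda>y. F y * (radial_dir x0 y $ i * (1 + y \<bullet> y) powr (- (1 / 2))))"
      by (intro times_cont_diff_on_mult F times_cont_diff_on_radial_dir open_punctured
          times_cont_diff_on_subset[OF times_cont_diff_on_sqrt_one_plus]) simp
  qed (simp add: F0)
  have H0: "H i y = 0" if "y \<notin> K" for i y using F0[of y] that by (auto simp: H_def)
  have zero: "has_bochner_integral lborel (\<lambda>y. \<Sum>i\<in>UNIV. frechet_derivative (H i) (at y) (axis i 1)) (\<Sum>i\<in>(UNIV :: 'n set). 0)"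
    using integral_directional_derivative_eq_0[OF tcdH K(1) H0] by (intro has_bochner_integral_sum)
  have pt: "(\<Sum>i\<in>UNIV. frechet_derivative (H i) (at y) (axis i 1)) = ?E y / ?s y" if y: "y \<noteq> p" for y
  proof -
    obtain W where W: "\<And>i. ((\<lambda>z. radial_dir x0 z $ i / ?s z) has_derivative W i) (at y)"
      and sumW: "(\<Sum>i\<in>UNIV. W i (axis i 1)) = (real CARD('n) - 1) * coth (rad x0 y) / ?s y"
      using sum_derivative_radial_dir[OF y] by blast
    have dF: "F differentiable (at y)" using F y by simp
    have dH: "(H i has_derivative (\<lambda>v. F y * W i v + frechet_derivative F (at y) v * (radial_dir x0 y $ i / ?s y))) (at y)" for i
    proof (rule has_derivative_transform_within_open[OF _ open_punctured])
      show "((\<lambda>z. F z * (radial_dir x0 z $ i / ?s z)) has_derivative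
         (\<lambda>v. F y * W i v + frechet_derivative F (at y) v * (radial_dir x0 y $ i / ?s y))) (at y)"
        using dF W by (intro has_derivative_mult) (simp_all add: frechet_derivative_works)
    qed (use y in \<open>auto simp: H_def spw\<close>)
    have "frechet_derivative (H i) (at y) v =
        F y * W i v + frechet_derivative F (at y) v * (radial_dir x0 y $ i / ?s y)" for i v
      using fun_cong[OF frechet_derivative_at[OF dH[of i]], of v] by simp
    then have "(\<Sum>i\<in>UNIV. frechet_derivative (H i) (at y) (axis i 1)) =
        F y * (\<Sum>i\<in>UNIV. W i (axis i 1)) + (\<Sum>i\<in>UNIV. radial_dir x0 y $ i * frechet_derivative F (at y) (axis i 1)) / ?s y"
      by (simp add: sum.distrib sum_distrib_left sum_divide_distrib mult_ac)
    also have "\<dots> = ?E y / ?s y"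
      unfolding sumW chart_radial_deriv_sum[OF dF] by (simp add: add_divide_distrib mult_ac)
    finally show ?thesis .
  qed
  have contE: "continuous_on (- {p}) ?E"
  proof (intro continuous_intros)
    show "continuous_on (- {p}) (chart_radial_deriv x0 F)"
      using times_cont_diff_on_chart_radial_deriv[of 0 F] F by simp
    show "continuous_on (- {p}) F" using times_cont_diff_on_imp_continuous[OF F] .
    have "continuous_on (- {p}) (rad x0)" using times_cont_diff_on_imp_continuous[OF times_cont_diff_on_rad] .
    then show "continuous_on (- {p}) (\<lambda>y. coth (rad x0 y))"
      unfolding coth_def using rad_pos by (intro continuous_intros) fastforce+
  qed
  have E0: "?E y = 0" if "y \<noteq> p" "y \<notin> K" for y
    using chart_radial_deriv_eq_0[OF K(1) F0 that] F0[OF that] by simp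
  have eq: "(\<integral>y. (if y = p then 0 else ?E y) / ?s y \<partial>lborel) = 0"
  proof -
    have "(\<integral>y. (if y = p then 0 else ?E y) / ?s y \<partial>lborel)
      = (\<integral>y. (\<Sum>i\<in>UNIV. frechet_derivative (H i) (at y) (axis i 1)) \<partial>lborel)"
    proof (rule integral_cong_AE)
      show "(\<lambda>y. (if y = p then 0 else ?E y) / ?s y) \<in> borel_measurable lborel"
        using has_bochner_integral_hyp_volume(1)[OF contE K E0 f] by blast
      show "(\<lambda>y. \<Sum>i\<in>UNIV. frechet_derivative (H i) (at y) (axis i 1)) \<in> borel_measurable lborel"
        using zero by (auto simp: has_bochner_integral_iff)
      show "AE y in lborel. (if y = p then 0 else ?E y) / ?s y = (\<Sum>i\<in>UNIV. frechet_derivative (H i) (at y) (axis i 1))"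
        using AE_lborel_singleton[of p] by eventually_elim (simp add: pt)
    qed
    then show ?thesis using zero by (simp add: has_bochner_integral_iff)
  qed
  show ?thesis using has_bochner_integral_hyp_volume(2)[OF contE K E0 f] unfolding eq by simp
qed

text \<open>If the integral were zero, the set where \<open>F\<close> is positive would be open and
  negligible, hence empty. The strict sign is what the failure of an inequality requires.\<close>

lemma hyp_volume_integral_pos:
  fixes F :: "real ^ 'n \<Rightarrow> real"
  assumes F: "continuous_on (- {p}) F" and K: "compact K" "p \<notin> K"
    and F0: "\<And>y. y \<noteq> p \<Longrightarrow> y \<notin> K \<Longrightarrow> F y = 0"
    and f: "\<And>y. y \<noteq> p \<Longrightarrow> f (graph_chart y) = F y"
    and nonneg: "\<And>y. y \<noteq> p \<Longrightarrow> F y \<ge> 0" and ex: "y1 \<noteq> p" "F y1 > 0"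
  shows "integral\<^sup>L hyp_volume f > 0"
proof -
  let ?G = "\<lambda>y. (if y = p then 0 else F y) / sqrt (1 + y \<bullet> y)"
  note I = has_bochner_integral_hyp_volume[OF F K F0 f]
  have s: "sqrt (1 + y \<bullet> y) > 0" for y :: "real ^ 'n" using one_plus_inner_pos[of y] by simp
  have G0: "?G y \<ge> 0" for y using nonneg[of y] s[of y] by auto
  have "integral\<^sup>L lborel ?G \<noteq> 0"
  proof
    assume "integral\<^sup>L lborel ?G = 0"
    then have "AE y in lborel. ?G y = 0"
      using integral_nonneg_eq_0_iff_AE[OF I(1)] G0 by simp
    then have ae: "AE y in lborel. y \<notin> {y \<in> - {p}. F y > 0}"
      by eventually_elim (use s in \<open>auto simp: less_imp_neq[symmetric] split: if_splits\<close>)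
    have op: "open {y \<in> - {p}. F y > 0}"
      using continuous_open_preimage[OF F open_punctured open_greaterThan[of 0]]
      by (simp add: vimage_def Int_def)
    have "{y \<in> - {p}. F y > 0} \<in> null_sets lborel"
      using ae op by (subst AE_iff_null_sets) auto
    then have "negligible {y \<in> - {p}. F y > 0}"
      by (simp add: negligible_iff_null_sets null_sets_completionI)
    then show False using open_not_negligible[OF op] ex by auto
  qed
  moreover have "integral\<^sup>L lborel ?G \<ge> 0" by (intro Bochner_Integration.integral_nonneg G0)
  ultimately show ?thesis using I(2) by (simp add: has_bochner_integral_iff)
qed

end

section \<open>The identity\<close>

lemma coth_has_derivative:
  assumes "r > 0"
  shows "(coth has_real_derivative - (1 / (sinh r)\<^sup>2)) (at r)"
proof -
  have "((\<lambda>r. cosh r / sinh r) has_real_derivative (sinh r * sinh r - cosh r * cosh r) / (sinh r * sinh r)) (at r)"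
    using assms by (auto intro!: derivative_eq_intros)
  then show ?thesis
    using cosh_square_eq[of r] by (simp add: coth_def[abs_def] power2_eq_square)
qed

lemma coth_sq: "r > 0 \<Longrightarrow> coth r * coth r = 1 + 1 / (sinh r)\<^sup>2" for r :: real
  using cosh_square_eq[of r] by (simp add: coth_def power2_eq_square field_simps)

text \<open>The logarithmic derivative of \<open>Psi\<close>. The powers of r in its two factors add
  up to - (N - 2) / 2 + (N - 1 + gam) / 2 = h.\<close>

definition Psi_log_deriv :: "nat \<Rightarrow> real \<Rightarrow> real \<Rightarrow> real" where
  "Psi_log_deriv N lam r = h N lam / r - (real N - 1 + gam N lam) / 2 * coth r"

lemma Psi_pos: "r > 0 \<Longrightarrow> Psi N lam r > 0"
  by (simp add: Psi_def)

lemma Psi_has_derivative: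
  assumes "r > 0"
  shows "(Psi N lam has_real_derivative Psi_log_deriv N lam r * Psi N lam r) (at r)"
proof -
  define a b where "a = - ((real N - 2) / 2)" and "b = - ((real N - 1 + gam N lam) / 2)"
  have S: "sinh r > 0" using assms by simp
  have 1: "((\<lambda>r. r powr a) has_real_derivative (a / r) * r powr a) (at r)"
    using assms by (auto intro!: derivative_eq_intros simp: powr_diff)
  have 2: "((\<lambda>r. (sinh r / r) powr b) has_real_derivative (b * (coth r - 1 / r)) * (sinh r / r) powr b) (at r)"
  proof (rule DERIV_cong)
    have "((\<lambda>r. sinh r / r) has_real_derivative (cosh r * r - sinh r * 1) / (r * r)) (at r)"
      using assms by (auto intro!: derivative_eq_intros)
    from DERIV_chain2[OF has_real_derivative_powr this, of b]
    show "((\<lambda>r. (sinh r / r) powr b) has_real_derivative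
        b * (sinh r / r) powr (b - 1) * ((cosh r * r - sinh r * 1) / (r * r))) (at r)"
      using S assms by simp
    have "(sinh r / r) powr (b - 1) = (sinh r / r) powr b * (r / sinh r)"
      using S assms by (simp add: powr_diff)
    then show "b * (sinh r / r) powr (b - 1) * ((cosh r * r - sinh r * 1) / (r * r))
        = (b * (coth r - 1 / r)) * (sinh r / r) powr b"
      using S assms by (simp add: coth_def field_simps)
  qed
  have "h N lam = a - b" by (simp add: a_def b_def h_def field_simps)
  then have hr: "h N lam / r = a / r - b / r" by (simp add: diff_divide_distrib)
  have bb: "(real N - 1 + gam N lam) / 2 = - b" by (simp add: b_def)
  have q: "Psi_log_deriv N lam r = a / r + b * (coth r - 1 / r)"
    unfolding Psi_log_deriv_def hr bb by (simp add: algebra_simps)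
  show ?thesis
    unfolding Psi_def[abs_def] q a_def[symmetric] b_def[symmetric]
    by (rule DERIV_cong[OF DERIV_mult[OF 1 2]]) (simp add: algebra_simps)
qed

text \<open>Isolates the singularity at the pole: r coth r - 1 tends to 0, so the leading
  coefficient 1 - N/2 is the same for every \<open>lam\<close>, and the same power of r serves in
  all test functions.\<close>

lemma Psi_log_deriv_eq:
  "r > 0 \<Longrightarrow> Psi_log_deriv N lam r =
    ((1 - real N / 2) - (real N - 1 + gam N lam) / 2 * (r * coth r - 1)) / r"
  by (simp add: Psi_log_deriv_def h_def field_simps)

text \<open>The pointwise form of the identity: up to the divergence of \<open>q f\<^sup>2 \<partial>\<^sub>r\<close>, with
  \<open>q = h / r + (N - 1 - (N - 1 + \<gamma>) / 2) coth r\<close>, the square of the Laplacian is the sum of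
  the other terms.\<close>

lemma rellich_pointwise:
  fixes f g r lam :: real and n :: nat
  assumes r: "r > 0" and lam: "lam \<le> ((real n - 1) / 2)\<^sup>2"
  defines "b \<equiv> (real n - 1 + gam n lam) / 2"
  defines "q \<equiv> h n lam / r + (real n - 1 - b) * coth r"
    and "q' \<equiv> - (h n lam / r\<^sup>2) - (real n - 1 - b) / (sinh r)\<^sup>2"
  shows "(g + (real n - 1) * coth r * f)\<^sup>2 =
    lam * f\<^sup>2 + (h n lam)\<^sup>2 * (f\<^sup>2 / r\<^sup>2) + ((real n / 2)\<^sup>2 - (h n lam)\<^sup>2) * (f\<^sup>2 / (sinh r)\<^sup>2)
    + gam n lam * h n lam * ((r * coth r - 1) / r\<^sup>2 * f\<^sup>2)
    + (g - Psi_log_deriv n lam r * f)\<^sup>2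
    + (q' * f\<^sup>2 + q * (2 * f * g) + (real n - 1) * coth r * (q * f\<^sup>2))"
proof -
  define H where "H = h n lam"
  define \<kappa> where "\<kappa> = coth r"
  define \<rho> where "\<rho> = 1 / r"
  define \<sigma> where "\<sigma> = 1 / (sinh r)\<^sup>2"
  have ksq: "\<sigma> = \<kappa> * \<kappa> - 1" using coth_sq[OF r] by (simp add: \<kappa>_def \<sigma>_def)
  \<comment> \<open>\<open>lam\<close>, \<open>gam\<close> and \<open>b\<close> become polynomials
    in N and H, and 1 / sinh^2 one in coth, so the claim turns into a polynomial identity in f, g,
    coth r and 1 / r. The upper bound on \<open>lam\<close> enters where \<open>gam\<close> is
    squared.\<close>
  have gm: "gam n lam = 2 * H - 1" by (simp add: H_def h_def field_simps)
  have "(gam n lam)\<^sup>2 = (real n - 1)\<^sup>2 - 4 * lam"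
    using lam by (simp add: gam_def power_divide)
  then have lm: "lam = ((real n - 1)\<^sup>2 - (2 * H - 1)\<^sup>2) / 4" by (simp add: gm)
  have bH: "b = (real n - 2) / 2 + H" by (simp add: b_def gm)
  have e: "H / r = H * \<rho>" "H / r\<^sup>2 = H * \<rho>\<^sup>2" "f\<^sup>2 / r\<^sup>2 = f\<^sup>2 * \<rho>\<^sup>2"
    "f\<^sup>2 / (sinh r)\<^sup>2 = f\<^sup>2 * \<sigma>" "(real n - 1 - b) / (sinh r)\<^sup>2 = (real n - 1 - b) * \<sigma>"
    "(r * \<kappa> - 1) / r\<^sup>2 * f\<^sup>2 = (\<kappa> * \<rho> - \<rho>\<^sup>2) * f\<^sup>2"
    using r by (simp_all add: \<rho>_def \<sigma>_def power_divide field_simps power2_eq_square)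
  have pl: "Psi_log_deriv n lam r = H * \<rho> - b * \<kappa>"
    by (simp add: Psi_log_deriv_def b_def \<kappa>_def H_def \<rho>_def)
  show ?thesis
    unfolding q_def q'_def e pl H_def[symmetric] \<kappa>_def[symmetric] gm
    unfolding lm bH ksq
    by (simp add: power2_eq_square field_simps)
qed

context pole
begin

section \<open>Radial operators on test functions, in the chart\<close>

lemma chart_radial_deriv_cong:
  assumes "\<And>z. z \<noteq> p \<Longrightarrow> F z = G z" and "y \<noteq> p" and "F differentiable (at y)"
  shows "chart_radial_deriv x0 G y = chart_radial_deriv x0 F y"
proof -
  have "(F has_derivative frechet_derivative F (at y)) (at y)"
    using assms(3) by (simp add: frechet_derivative_works)
  then have "(G has_derivative frechet_derivative F (at y)) (at y)"
    by (rule has_derivative_transform_within_open[OF _ open_punctured]) (use assms in auto)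
  then have "chart_radial_deriv x0 G y = frechet_derivative F (at y) (radial_dir x0 y)"
    by (rule chart_radial_deriv_eqI)
  then show ?thesis unfolding chart_radial_deriv_def .
qed

text \<open>The support is projected from the hyperboloid to the chart; the projection is injective
  there, so the image still misses the pole.\<close>

lemma test_function_chart:
  assumes "u \<in> test_functions x0"
  obtains K where "compact K" and "p \<notin> K" and "\<And>k. times_cont_diff_on k (- {p}) (\<lambda>y. u (graph_chart y))"
    and "\<And>y. y \<noteq> p \<Longrightarrow> y \<notin> K \<Longrightarrow> u (graph_chart y) = 0"
proof -
  obtain K where K: "compact K" "K \<subseteq> hyperbolic_space - {x0}" "\<And>x. x \<in> hyperbolic_space - {x0} - K \<Longrightarrow> u x = 0"
    and sm: "smooth_on {y. graph_chart y \<noteq> x0} (\<lambda>y. u (graph_chart y))"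
    using assms by (auto simp: test_functions_def)
  have eq: "{y. graph_chart y \<noteq> x0} = - {p}" by (auto simp: graph_chart_neq_x0)
  show thesis
  proof
    show "compact (fst ` K)" using K(1) by (intro compact_continuous_image continuous_intros)
    show "p \<notin> fst ` K" using K(2) graph_chart_fst graph_chart_fst[OF x0] by force
    show "times_cont_diff_on k (- {p}) (\<lambda>y. u (graph_chart y))" for k
      using sm unfolding eq smooth_on_def by simp
    show "u (graph_chart y) = 0" if "y \<noteq> p" "y \<notin> fst ` K" for y
      using that K(3)[of "graph_chart y"] graph_chart_in_hyperbolic_space[of y] graph_chart_neq_x0[of y]
        image_eqI[of y fst "graph_chart y" K] by auto
  qed
qed

lemma radial_laplacian_chart:
  assumes "CARD('n) \<ge> 2" and "y \<noteq> p" and "times_cont_diff_on 2 (- {p}) (\<lambda>y. u (graph_chart y))"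
  defines "f \<equiv> chart_radial_deriv x0 (\<lambda>y. u (graph_chart y))"
  shows "radial_laplacian x0 u (graph_chart y) =
    chart_radial_deriv x0 f y + (real CARD('n) - 1) * coth (rad x0 y) * f y"
proof -
  let ?n = "CARD('n)" and ?r = "rad x0 y"
  have f: "times_cont_diff_on 1 (- {p}) f"
    unfolding f_def using assms(3) by (intro times_cont_diff_on_chart_radial_deriv) (simp add: numeral_2_eq_2)
  have rf: "radial_deriv x0 u (graph_chart z) = f z" if "z \<noteq> p" for z
    unfolding f_def using that assms(3) by (intro radial_deriv_chart) (simp_all add: numeral_2_eq_2)
  have df: "f differentiable (at y)" using f assms(2) by simp
  have "((\<lambda>r. sinh r ^ (?n - 1)) has_real_derivative real (?n - 1) * sinh ?r ^ (?n - 2) * cosh ?r) (at ?r)"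
    by (auto intro!: derivative_eq_intros simp: numeral_2_eq_2)
  note G = chart_radial_deriv_compose_rad[OF assms(2) this]
  have "radial_deriv x0 (\<lambda>x. sinh (hyp_dist x x0) ^ (?n - 1) * radial_deriv x0 u x) (graph_chart y)
      = chart_radial_deriv x0 (\<lambda>z. sinh (rad x0 z) ^ (?n - 1) * f z) y"
    using assms(2) G(1) df by (intro radial_deriv_chart) (auto simp: rf rad_def)
  also have "\<dots> = sinh ?r ^ (?n - 1) * chart_radial_deriv x0 f y + real (?n - 1) * sinh ?r ^ (?n - 2) * cosh ?r * f y"
    unfolding chart_radial_deriv_mult[OF G(1) df] G(2) ..
  finally have "radial_laplacian x0 u (graph_chart y) =
     (sinh ?r ^ (?n - 1) * chart_radial_deriv x0 f y + real (?n - 1) * sinh ?r ^ (?n - 2) * cosh ?r * f y)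
       / sinh ?r ^ (?n - 1)"
    by (simp add: radial_laplacian_def rad_def)
  moreover define P where "P = sinh ?r ^ (?n - 2)"
  \<comment> \<open>The exponents are natural-number subtractions; N \<ge> 2 makes N - 1 the
    successor of N - 2, so one factor sinh r splits off.\<close>
  moreover have "sinh ?r ^ (?n - 1) = sinh ?r * P"
  proof -
    have "?n - 1 = Suc (?n - 2)" using assms(1) by simp
    then show ?thesis by (simp only: P_def power_Suc)
  qed
  moreover have "real (?n - 1) = real ?n - 1" using assms(1) by (simp add: of_nat_diff)
  ultimately have "radial_laplacian x0 u (graph_chart y) =
     (sinh ?r * P * chart_radial_deriv x0 f y + (real ?n - 1) * P * cosh ?r * f y) / (sinh ?r * P)"
    by (simp only:)
  moreover have "sinh ?r > 0" "P > 0" using rad_pos[OF assms(2)] by (simp_all add: P_def)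
  ultimately show ?thesis
    by (simp add: coth_def add_divide_distrib)
qed

text \<open>In the remainder this quotient is squared and multiplied by the square of
  \<open>Psi\<close>, so that only the logarithmic derivative of \<open>Psi\<close> survives. That
  is the form in which the pointwise identity contains it.\<close>

lemma radial_deriv_div_Psi_chart:
  assumes "y \<noteq> p" and "times_cont_diff_on 1 (- {p}) f"
    and "\<And>z. z \<noteq> p \<Longrightarrow> radial_deriv x0 u (graph_chart z) = f z"
  shows "radial_deriv x0 (\<lambda>x. radial_deriv x0 u x / Psi N lam (hyp_dist x x0)) (graph_chart y) =
    (chart_radial_deriv x0 f y - Psi_log_deriv N lam (rad x0 y) * f y) / Psi N lam (rad x0 y)"
proof -
  let ?r = "rad x0 y"
  have r: "?r > 0" using rad_pos[OF assms(1)] .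
  have P: "Psi N lam ?r > 0" using Psi_pos[OF r] .
  have df: "f differentiable (at y)" using assms by simp
  have "((\<lambda>r. inverse (Psi N lam r)) has_real_derivative - (Psi_log_deriv N lam ?r / Psi N lam ?r)) (at ?r)"
    using P by (auto intro!: derivative_eq_intros Psi_has_derivative[OF r] simp: field_simps)
  note G = chart_radial_deriv_compose_rad[OF assms(1) this]
  have "radial_deriv x0 (\<lambda>x. radial_deriv x0 u x / Psi N lam (hyp_dist x x0)) (graph_chart y)
     = chart_radial_deriv x0 (\<lambda>z. inverse (Psi N lam (rad x0 z)) * f z) y"
    using assms(1) G(1) df by (intro radial_deriv_chart) (auto simp: assms(3) rad_def divide_inverse)
  also have "\<dots> = (chart_radial_deriv x0 f y - Psi_log_deriv N lam (rad x0 y) * f y) / Psi N lam (rad x0 y)"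
    unfolding chart_radial_deriv_mult[OF G(1) df] G(2) using P by (simp add: field_simps)
  finally show ?thesis .
qed

lemma continuous_on_rad: "continuous_on (- {p}) (rad x0)"
  using times_cont_diff_on_imp_continuous[OF times_cont_diff_on_rad] .

lemma continuous_on_coth_rad: "continuous_on (- {p}) (\<lambda>y. coth (rad x0 y))"
  unfolding coth_def using rad_pos by (intro continuous_intros continuous_on_rad) fastforce

text \<open>All six integrands are integrable one by one: f and its radial derivative vanish outside
  a compact set missing the pole, and 1 / r, coth r and 1 / sinh r are continuous off the pole.
  Hence the integral of the pointwise identity may be split.\<close>

lemma rellich_identity:
  assumes n: "CARD('n) \<ge> 2" and u: "u \<in> test_functions x0" and lam: "lam \<le> ((real CARD('n) - 1) / 2)\<^sup>2"
  shows "(\<integral>x. \<bar>radial_laplacian x0 u x\<bar>\<^sup>2 \<partial>hyp_volume) =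
        lam * (\<integral>x. sq_norm (radial_grad x0 u x) \<partial>hyp_volume)
        + (h CARD('n) lam)\<^sup>2 *
            (\<integral>x. sq_norm (radial_grad x0 u x) / (hyp_dist x x0)\<^sup>2 \<partial>hyp_volume)
        + ((real CARD('n) / 2)\<^sup>2 - (h CARD('n) lam)\<^sup>2) *
            (\<integral>x. sq_norm (radial_grad x0 u x) / (sinh (hyp_dist x x0))\<^sup>2 \<partial>hyp_volume)
        + gam CARD('n) lam * h CARD('n) lam *
            (\<integral>x. (hyp_dist x x0 * coth (hyp_dist x x0) - 1) / (hyp_dist x x0)\<^sup>2
                   * sq_norm (radial_grad x0 u x) \<partial>hyp_volume)
        + (\<integral>x. (Psi CARD('n) lam (hyp_dist x x0))\<^sup>2
                 * sq_norm (radial_grad x0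
                     (\<lambda>y. radial_deriv x0 u y / Psi CARD('n) lam (hyp_dist y x0)) x) \<partial>hyp_volume)"
    (is "integral\<^sup>L hyp_volume ?I0 = lam * integral\<^sup>L hyp_volume ?I1 + ?c2 * integral\<^sup>L hyp_volume ?I2
      + ?c3 * integral\<^sup>L hyp_volume ?I3 + ?c4 * integral\<^sup>L hyp_volume ?I4 + integral\<^sup>L hyp_volume ?I5")
proof -
  obtain K where K: "compact K" "p \<notin> K" and sm: "\<And>k. times_cont_diff_on k (- {p}) (\<lambda>y. u (graph_chart y))"
    and U0: "\<And>y. y \<noteq> p \<Longrightarrow> y \<notin> K \<Longrightarrow> u (graph_chart y) = 0"
    using test_function_chart[OF u] by blast
  define f where "f = chart_radial_deriv x0 (\<lambda>y. u (graph_chart y))"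
  define g where "g = chart_radial_deriv x0 f"
  define b where "b = (real CARD('n) - 1 + gam CARD('n) lam) / 2"
  have f: "times_cont_diff_on k (- {p}) f" for k
    unfolding f_def by (intro times_cont_diff_on_chart_radial_deriv sm)
  have g: "times_cont_diff_on k (- {p}) g" for k
    unfolding g_def by (intro times_cont_diff_on_chart_radial_deriv f)
  have cf: "continuous_on (- {p}) f" and cg: "continuous_on (- {p}) g"
    using times_cont_diff_on_imp_continuous[OF f] times_cont_diff_on_imp_continuous[OF g] by auto
  have f0: "f y = 0" if "y \<noteq> p" "y \<notin> K" for y
    unfolding f_def by (rule chart_radial_deriv_eq_0[OF K(1) U0 that])
  have g0: "g y = 0" if "y \<noteq> p" "y \<notin> K" for y
    unfolding g_def by (rule chart_radial_deriv_eq_0[OF K(1) f0 that])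
  have rf: "radial_deriv x0 u (graph_chart z) = f z" if "z \<noteq> p" for z
    unfolding f_def using that sm[of 1] by (intro radial_deriv_chart) simp_all
  have rp: "rad x0 y > 0" "rad x0 y \<noteq> 0" "sinh (rad x0 y) \<noteq> 0" if "y \<noteq> p" for y
    using rad_pos[OF that] by auto
  have hd: "hyp_dist (graph_chart y) x0 = rad x0 y" for y by (simp add: rad_def)
  have I0: "(radial_laplacian x0 u (graph_chart y))\<^sup>2 = (g y + (real CARD('n) - 1) * coth (rad x0 y) * f y)\<^sup>2" if "y \<noteq> p" for y
    using radial_laplacian_chart[OF n that sm] by (simp add: f_def[symmetric] g_def[symmetric])
  have sg: "sq_norm (radial_grad x0 u (graph_chart y)) = (f y)\<^sup>2" if "y \<noteq> p" for y
    using that by (simp add: sq_norm_radial_grad_chart rf)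
  have I5: "?I5 (graph_chart y) = (g y - Psi_log_deriv CARD('n) lam (rad x0 y) * f y)\<^sup>2" if "y \<noteq> p" for y
    using that Psi_pos[OF rp(1)[OF that], of "CARD('n)" lam]
    by (simp add: sq_norm_radial_grad_chart radial_deriv_div_Psi_chart[OF that f rf] g_def hd power_divide)
  note int = hyp_volume_integrable[OF _ K]
  note ci = continuous_intros cf cg continuous_on_rad continuous_on_coth_rad
  have i0: "integrable hyp_volume ?I0"
    by (rule int[where F = "\<lambda>y. (g y + (real CARD('n) - 1) * coth (rad x0 y) * f y)\<^sup>2"])
      (auto intro!: ci simp: f0 g0 I0)
  have i1: "integrable hyp_volume ?I1"
    by (rule int[where F = "\<lambda>y. (f y)\<^sup>2"]) (auto intro!: ci simp: f0 sg)
  have i2: "integrable hyp_volume ?I2"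
    by (rule int[where F = "\<lambda>y. (f y)\<^sup>2 / (rad x0 y)\<^sup>2"]) (auto intro!: ci simp: f0 sg hd rp)
  have i3: "integrable hyp_volume ?I3"
    by (rule int[where F = "\<lambda>y. (f y)\<^sup>2 / (sinh (rad x0 y))\<^sup>2"]) (auto intro!: ci simp: f0 sg hd rp)
  have i4: "integrable hyp_volume ?I4"
    by (rule int[where F = "\<lambda>y. (rad x0 y * coth (rad x0 y) - 1) / (rad x0 y)\<^sup>2 * (f y)\<^sup>2"])
      (auto intro!: ci simp: f0 sg hd rp)
  have cq: "continuous_on (- {p}) (\<lambda>y. Psi_log_deriv CARD('n) lam (rad x0 y))"
    unfolding Psi_log_deriv_def by (intro ci) (auto simp: rp)
  have i5: "integrable hyp_volume ?I5"
    by (rule int[where F = "\<lambda>y. (g y - Psi_log_deriv CARD('n) lam (rad x0 y) * f y)\<^sup>2"])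
      (auto intro!: ci cq simp: f0 g0 I5)
  \<comment> \<open>This is (N - 1) coth r + \<open>Psi_log_deriv\<close>.\<close>
  define q where "q r = h CARD('n) lam / r + (real CARD('n) - 1 - b) * coth r" for r
  have tq: "times_cont_diff_on 1 (- {p}) (\<lambda>y. q (rad x0 y) * (f y * f y))"
  proof (intro times_cont_diff_on_mult open_punctured f)
    have "times_cont_diff_on 1 (- {p}) (\<lambda>y. h CARD('n) lam * rad x0 y powr - 1
        + (real CARD('n) - 1 - b) * (ch x0 y * sh x0 y powr - 1))"
      by (intro times_cont_diff_on_add times_cont_diff_on_mult times_cont_diff_on_const open_punctured
          times_cont_diff_on_powr times_cont_diff_on_rad times_cont_diff_on_sh_powr
          times_cont_diff_on_subset[OF times_cont_diff_on_ch] rp) auto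
    then show "times_cont_diff_on 1 (- {p}) (\<lambda>y. q (rad x0 y))"
    proof (rule times_cont_diff_on_cong[OF open_punctured, rotated])
      fix y assume "y \<in> - {p}"
      then have "rad x0 y > 0" "sh x0 y > 0" using rad_pos sh_pos by auto
      then show "h CARD('n) lam * rad x0 y powr - 1 + (real CARD('n) - 1 - b) * (ch x0 y * sh x0 y powr - 1) = q (rad x0 y)"
        by (simp add: q_def coth_def cosh_rad sinh_rad powr_minus divide_inverse)
    qed
  qed
  have "has_bochner_integral hyp_volume
     (\<lambda>x. ?I0 x - (lam * ?I1 x + ?c2 * ?I2 x + ?c3 * ?I3 x + ?c4 * ?I4 x + ?I5 x)) 0"
  proof (rule hyp_volume_radial_divergence[OF tq K])
    fix y assume y: "y \<noteq> p"
    show "y \<notin> K \<Longrightarrow> q (rad x0 y) * (f y * f y) = 0" using f0 y by simp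
    let ?q' = "- (h CARD('n) lam / (rad x0 y)\<^sup>2) - (real CARD('n) - 1 - b) / (sinh (rad x0 y))\<^sup>2"
    have "(q has_real_derivative ?q') (at (rad x0 y))"
      unfolding q_def[abs_def] using rp[OF y]
      by (auto intro!: derivative_eq_intros coth_has_derivative simp: power2_eq_square)
    note Q = chart_radial_deriv_compose_rad[OF y this]
    have df: "f differentiable (at y)" using f[of 1] y by simp
    have dff: "(\<lambda>z. f z * f z) differentiable (at y)" by (intro differentiable_mult df)
    have "chart_radial_deriv x0 (\<lambda>y. q (rad x0 y) * (f y * f y)) y = ?q' * (f y)\<^sup>2 + q (rad x0 y) * (2 * f y * g y)"
      unfolding chart_radial_deriv_mult[OF Q(1) dff] chart_radial_deriv_mult[OF df df] Q(2) g_def[symmetric]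
      by (simp add: power2_eq_square algebra_simps)
    moreover have "f y * f y = (f y)\<^sup>2" by (simp only: power2_eq_square)
    moreover note rellich_pointwise[OF rp(1)[OF y] lam, of "g y" "f y", folded b_def, folded q_def]
    ultimately show "?I0 (graph_chart y) - (lam * ?I1 (graph_chart y) + ?c2 * ?I2 (graph_chart y) + ?c3 * ?I3 (graph_chart y)
        + ?c4 * ?I4 (graph_chart y) + ?I5 (graph_chart y)) =
      chart_radial_deriv x0 (\<lambda>y. q (rad x0 y) * (f y * f y)) y
        + (real CARD('n) - 1) * coth (rad x0 y) * (q (rad x0 y) * (f y * f y))"
      unfolding power2_abs I0[OF y] I5[OF y] unfolding sg[OF y] hd
      by (simp only:)
  qed
  then have "integral\<^sup>L hyp_volume (\<lambda>x. ?I0 x - (lam * ?I1 x + ?c2 * ?I2 x + ?c3 * ?I3 x + ?c4 * ?I4 x + ?I5 x)) = 0"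
    by (simp add: has_bochner_integral_iff)
  moreover have "integral\<^sup>L hyp_volume (\<lambda>x. ?I0 x - (lam * ?I1 x + ?c2 * ?I2 x + ?c3 * ?I3 x + ?c4 * ?I4 x + ?I5 x)) =
     integral\<^sup>L hyp_volume ?I0 - (lam * integral\<^sup>L hyp_volume ?I1 + ?c2 * integral\<^sup>L hyp_volume ?I2
      + ?c3 * integral\<^sup>L hyp_volume ?I3 + ?c4 * integral\<^sup>L hyp_volume ?I4 + integral\<^sup>L hyp_volume ?I5)"
    by (subst Bochner_Integration.integral_diff Bochner_Integration.integral_add
        | intro i0 i1 i2 i3 i4 i5 Bochner_Integration.integrable_add integrable_mult_right
        | simp only: integral_mult_right_zero)+
  ultimately show ?thesis
    by linarith
qed

end

section \<open>Sharpness\<close>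

text \<open>Take \<open>c\<close> as the quotient of the integrals of \<open>w\<close> and
  \<open>e\<close>; then \<open>w - c * e\<close> has mean zero, and its antiderivative vanishing at
  \<open>a\<close> vanishes at \<open>b\<close> and beyond. With e = \<eta>^2 this trades the
  derivative terms of the remainder for a multiple of \<eta>^2 plus an exact derivative, which turns
  into a divergence. It replaces a comparison of one-dimensional integrals.\<close>

lemma compactly_supported_antiderivative:
  fixes w e :: "real \<Rightarrow> real"
  assumes "a < b" and w: "continuous_on UNIV w" "\<And>t. t \<notin> {a<..<b} \<Longrightarrow> w t = 0"
    and e: "continuous_on UNIV e" "\<And>t. t \<notin> {a<..<b} \<Longrightarrow> e t = 0" "\<And>t. t \<in> {a<..<b} \<Longrightarrow> e t > 0"
  obtains c Q where "\<And>t. (Q has_real_derivative w t - c * e t) (at t)" and "\<And>t. t \<notin> {a<..<b} \<Longrightarrow> Q t = 0"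
proof -
  have anti: "\<exists>P. \<forall>t. (P has_real_derivative v t) (at t)" if "continuous_on UNIV v" for v :: "real \<Rightarrow> real"
    using einterval_antiderivative[of "- \<infinity>" "\<infinity>" v] that
    by (auto simp: has_real_derivative_iff_has_vector_derivative continuous_on_eq_continuous_at)
  obtain P where P: "\<And>t. (P has_real_derivative w t) (at t)" using anti[OF w(1)] by blast
  obtain R where R: "\<And>t. (R has_real_derivative e t) (at t)" using anti[OF e(1)] by blast
  obtain z where z: "z > a" "z < b" "R b - R a = (b - a) * e z"
    using MVT2[OF assms(1), of R e] R by blast
  then have Rpos: "R b - R a > 0" using assms(1) e(3)[of z] by simp
  define c where "c = (P b - P a) / (R b - R a)"
  define Q where "Q t = P t - c * R t - (P a - c * R a)" for t
  have Q: "(Q has_real_derivative w t - c * e t) (at t)" for t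
    unfolding Q_def[abs_def] by (auto intro!: derivative_eq_intros P R)
  have cst: "Q s = Q t" if st: "s < t" and out: "\<And>z. s < z \<Longrightarrow> z < t \<Longrightarrow> z \<notin> {a<..<b}" for s t
  proof -
    obtain z where "z > s" "z < t" "Q t - Q s = (t - s) * (w z - c * e z)"
      using MVT2[OF st, of Q "\<lambda>t. w t - c * e t"] Q by blast
    then show ?thesis using st out[of z] w(2)[of z] e(2)[of z] by simp
  qed
  have Qa: "Q a = 0" by (simp add: Q_def)
  have "c * (R b - R a) = P b - P a" using Rpos by (simp add: c_def)
  then have Qb: "Q b = 0" by (simp add: Q_def algebra_simps)
  have "Q t = 0" if "t \<notin> {a<..<b}" for t
  proof (cases "t \<le> a")
    case True
    then show ?thesis using cst[of t a] Qa by (cases "t = a") auto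
  next
    case False
    then show ?thesis using cst[of b t] Qb that by (cases "t = b") auto
  qed
  with Q show thesis using that by blast
qed

text \<open>Both quantities measure the deviation from flat space near the pole: sinh r / r tends to
  1 and r coth r - 1 to 0. \<open>b\<close> is left free to collect the constants of the remainder
  estimate.\<close>

lemma small_radius:
  fixes b e :: real
  assumes "e > 0"
  obtains d where "d > 0" and "\<And>r. 0 < r \<Longrightarrow> r < d \<Longrightarrow> sinh r / r \<le> 2 \<and> b * (r * coth r - 1)\<^sup>2 \<le> e"
proof -
  have "((\<lambda>r::real. sinh r / r) \<longlongrightarrow> 1) (at_right 0)" by real_asymp
  then have 1: "eventually (\<lambda>r::real. sinh r / r < 2) (at_right 0)" by (rule order_tendstoD) simp
  have "((\<lambda>r::real. (r * (cosh r / sinh r) - 1)\<^sup>2) \<longlongrightarrow> 0) (at_right 0)" by real_asymp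
  from tendsto_mult_right_zero[OF this, of b]
  have "eventually (\<lambda>r. b * (r * coth r - 1)\<^sup>2 < e) (at_right 0)"
    unfolding coth_def by (rule order_tendstoD) (rule assms)
  with 1 have "eventually (\<lambda>r. sinh r / r \<le> 2 \<and> b * (r * coth r - 1)\<^sup>2 \<le> e) (at_right 0)"
    by eventually_elim auto
  then obtain d where "d > 0" "\<And>r. r > 0 \<Longrightarrow> r < d \<Longrightarrow> sinh r / r \<le> 2 \<and> b * (r * coth r - 1)\<^sup>2 \<le> e"
    unfolding eventually_at_right[OF zero_less_one] by auto
  then show thesis using that by blast
qed

lemma sinh_ge_self:
  fixes r :: real
  assumes "r \<ge> 0" shows "r \<le> sinh r"
proof -
  have "sinh 0 - 0 \<le> sinh r - r"
    by (rule DERIV_nonneg_imp_nondecreasing[OF assms, of "\<lambda>r. sinh r - r"])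
      (auto intro!: exI derivative_eq_intros simp: cosh_real_ge_1)
  then show ?thesis by simp
qed

lemma power2_diff_le: "(x - y)\<^sup>2 \<le> 2 * x\<^sup>2 + 2 * y\<^sup>2" for x y :: real
  using zero_le_power2[of "x + y"] by (simp add: power2_eq_square algebra_simps)

lemma power2_sum_le: "(x + y)\<^sup>2 \<le> 2 * x\<^sup>2 + 2 * y\<^sup>2" for x y :: real
  using power2_diff_le[of x "- y"] by simp

text \<open>The test functions are \<open>r powr \<alpha> * \<eta> (ln r / k)\<close> with \<open>\<alpha> = 2 - N / 2\<close>: in the variable
  \<open>ln r\<close> the remainder becomes, near the pole, a Dirichlet integral, which is negligible compared with
  the \<open>L\<^sup>2\<close> norm of functions spread over a length \<open>k\<close>.  The comparison is made pointwise up to the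
  divergence of a radial field, so that no integration in polar coordinates is needed.\<close>

lemma remainder_lower_bound:
  fixes n :: nat and r e b k w \<alpha> H H1 H2 c q' S :: real
  assumes n: "n \<ge> 3" and r: "r > 0" and k: "k \<ge> 1" and e: "e > 0"
    and S: "r \<le> S" "S / r \<le> 2" and small: "2 * 2 ^ (n - 1) * b\<^sup>2 * w\<^sup>2 \<le> e / 2"
    and q: "q' = \<alpha>\<^sup>2 * H1\<^sup>2 + H2\<^sup>2 - c * H\<^sup>2"
  defines "\<psi> \<equiv> \<alpha> * H + H1 / k" and "\<psi>1 \<equiv> \<alpha> * H1 + H2 / k"
  shows "(e / 2 * \<alpha>\<^sup>2 - 4 * 2 ^ (n - 1) * c / k\<^sup>2) * H\<^sup>2 / (r * S ^ (n - 1))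
      + (e * \<alpha> / k * (H * H1) - 4 * 2 ^ (n - 1) / k\<^sup>2 * q') / (r * S ^ (n - 1))
    \<le> e * (\<psi>\<^sup>2 / r ^ (n - 2)) / S\<^sup>2 - (\<psi>1 / k - b * w * \<psi>)\<^sup>2 / r ^ n"
proof -
  \<comment> \<open>After multiplication by r S^(n - 1) only powers of \<sigma> remain, which lie
    between 1 and powers of 2. The lower of the two exponents is n - 3, whence n \<ge> 3.\<close>
  define \<sigma> where "\<sigma> = S / r"
  have s: "\<sigma> \<ge> 1" "\<sigma> \<le> 2" using r S by (simp_all add: \<sigma>_def)
  have S': "S = \<sigma> * r" "S > 0" using r S by (simp_all add: \<sigma>_def)
  obtain m where m: "n = Suc (Suc (Suc m))"
    using n by (metis Suc_le_D numeral_3_eq_3 Suc_le_mono)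
  define T where "T = (2::real) ^ (n - 1)"
  have pos: "r * S ^ (n - 1) > 0" using r S' by simp
  have "(e * (\<psi>\<^sup>2 / r ^ (n - 2)) / S\<^sup>2 - (\<psi>1 / k - b * w * \<psi>)\<^sup>2 / r ^ n) * (r * S ^ (n - 1))
      = e * \<psi>\<^sup>2 * \<sigma> ^ m - (\<psi>1 / k - b * w * \<psi>)\<^sup>2 * \<sigma> ^ (n - 1)"
    using r s by (simp add: S'(1) m power_mult_distrib field_simps power2_eq_square)
  also have "\<dots> \<ge> e * \<psi>\<^sup>2 * 1 - (2 * (\<psi>1 / k)\<^sup>2 + 2 * (b * w * \<psi>)\<^sup>2) * T"
  proof (intro diff_mono mult_mono)
    show "1 \<le> \<sigma> ^ m" using s by simp
    show "\<sigma> ^ (n - 1) \<le> T" unfolding T_def using s by (intro power_mono) auto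
    show "(\<psi>1 / k - b * w * \<psi>)\<^sup>2 \<le> 2 * (\<psi>1 / k)\<^sup>2 + 2 * (b * w * \<psi>)\<^sup>2"
      by (rule power2_diff_le)
  qed (use e s in auto)
  also have "e * \<psi>\<^sup>2 * 1 - (2 * (\<psi>1 / k)\<^sup>2 + 2 * (b * w * \<psi>)\<^sup>2) * T
      = e * \<psi>\<^sup>2 - 2 * T * \<psi>1\<^sup>2 / k\<^sup>2 - (2 * T * b\<^sup>2 * w\<^sup>2) * \<psi>\<^sup>2"
    by (simp add: power_mult_distrib power_divide algebra_simps)
  \<comment> \<open>The coth correction uses up half of e. In the bound for \<psi>1 the factor 1 /
    k^2 in front of H2^2 is given away, so that the combination of H1 and H2 does not depend on k
    and its antiderivative can be fixed before k.\<close>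
  also have "\<dots> \<ge> e * \<psi>\<^sup>2 - 2 * T * (2 * (\<alpha>\<^sup>2 * H1\<^sup>2 + H2\<^sup>2)) / k\<^sup>2 - e / 2 * \<psi>\<^sup>2"
  proof (intro diff_mono order_refl divide_right_mono mult_left_mono mult_right_mono)
    show "2 * T * b\<^sup>2 * w\<^sup>2 \<le> e / 2" using small by (simp add: T_def)
    have "\<psi>1\<^sup>2 \<le> 2 * (\<alpha> * H1)\<^sup>2 + 2 * (H2 / k)\<^sup>2"
      unfolding \<psi>1_def by (rule power2_sum_le)
    moreover have "(H2 / k)\<^sup>2 \<le> H2\<^sup>2"
      using k by (simp add: power_divide divide_le_eq mult_le_cancel_left1 one_le_power zero_less_power2)
    ultimately show "\<psi>1\<^sup>2 \<le> 2 * (\<alpha>\<^sup>2 * H1\<^sup>2 + H2\<^sup>2)" by (simp add: power_mult_distrib)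
  qed (auto simp: T_def)
  also have "e * \<psi>\<^sup>2 - 2 * T * (2 * (\<alpha>\<^sup>2 * H1\<^sup>2 + H2\<^sup>2)) / k\<^sup>2 - e / 2 * \<psi>\<^sup>2
      = e / 2 * \<psi>\<^sup>2 - 4 * T * (\<alpha>\<^sup>2 * H1\<^sup>2 + H2\<^sup>2) / k\<^sup>2"
    by simp
  \<comment> \<open>The square of H1 / k is discarded, but the mixed term has no sign. It is kept
    because, with H1 the derivative of H, the product H H1 is an exact derivative.\<close>
  also have "\<dots> \<ge> e / 2 * (\<alpha>\<^sup>2 * H\<^sup>2 + 2 * \<alpha> * (H * H1) / k) - 4 * T * (\<alpha>\<^sup>2 * H1\<^sup>2 + H2\<^sup>2) / k\<^sup>2"
  proof (intro diff_mono order_refl mult_left_mono)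
    have "\<psi>\<^sup>2 = \<alpha>\<^sup>2 * H\<^sup>2 + 2 * \<alpha> * (H * H1) / k + (H1 / k)\<^sup>2"
      by (simp add: \<psi>_def power2_eq_square algebra_simps)
    then show "\<alpha>\<^sup>2 * H\<^sup>2 + 2 * \<alpha> * (H * H1) / k \<le> \<psi>\<^sup>2" by simp
  qed (use e in auto)
  also have "e / 2 * (\<alpha>\<^sup>2 * H\<^sup>2 + 2 * \<alpha> * (H * H1) / k) - 4 * T * (\<alpha>\<^sup>2 * H1\<^sup>2 + H2\<^sup>2) / k\<^sup>2
      = (e / 2 * \<alpha>\<^sup>2 - 4 * T * c / k\<^sup>2) * H\<^sup>2 + (e * \<alpha> / k * (H * H1) - 4 * T / k\<^sup>2 * q')"
    unfolding q using k by (simp add: field_simps)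
  finally have "(e / 2 * \<alpha>\<^sup>2 - 4 * T * c / k\<^sup>2) * H\<^sup>2 + (e * \<alpha> / k * (H * H1) - 4 * T / k\<^sup>2 * q')
     \<le> (e * (\<psi>\<^sup>2 / r ^ (n - 2)) / S\<^sup>2 - (\<psi>1 / k - b * w * \<psi>)\<^sup>2 / r ^ n) * (r * S ^ (n - 1))" .
  then show ?thesis
    using pos unfolding T_def[symmetric] add_divide_distrib[symmetric] by (simp add: pos_divide_le_eq)
qed

section \<open>Radial test functions concentrating at the pole\<close>

context pole
begin

text \<open>The growth is linear because c - |p| > 0, \<open>x0\<close> being timelike. Hence
  geodesic balls are bounded in the chart, and arbitrarily large distances occur.\<close>

lemma ch_ge_norm: "ch x0 y \<ge> norm y * (c - norm p)" and norm_p_less: "norm p < c"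
proof -
  have "(norm p)\<^sup>2 < c\<^sup>2" using c_sq by (simp add: power2_norm_eq_inner power2_eq_square[of c])
  then show "norm p < c" using c_pos by (metis less_imp_le power2_less_imp_less)
  have "norm y \<le> sqrt (1 + y \<bullet> y)" by (simp add: norm_eq_sqrt_inner)
  then have "norm y * c \<le> sqrt (1 + y \<bullet> y) * c" using c_pos by simp
  moreover have "y \<bullet> p \<le> norm y * norm p" by (rule norm_cauchy_schwarz)
  ultimately show "ch x0 y \<ge> norm y * (c - norm p)" by (simp add: ch_eq algebra_simps)
qed

lemma continuous_on_ch: "continuous_on UNIV (ch x0)"
  using times_cont_diff_on_imp_continuous[OF times_cont_diff_on_ch] .

lemma compact_annulus: "compact {y. rad x0 y \<in> {a..b}}" and annulus_pole: "a > 0 \<Longrightarrow> p \<notin> {y. rad x0 y \<in> {a..b}}"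
proof -
  have rc: "continuous_on UNIV (rad x0)"
  proof -
    have "continuous_on {1..} (arcosh :: real \<Rightarrow> real)" by (intro continuous_intros) auto
    then show ?thesis unfolding rad_eq[abs_def]
      by (rule continuous_on_compose2[OF _ continuous_on_ch]) (use ch_ge_1 in auto)
  qed
  have "closed {y. rad x0 y \<in> {a..b}}"
    using continuous_closed_vimage[of "{a..b}" "rad x0"] rc
    by (simp add: vimage_def continuous_on_eq_continuous_at)
  moreover have "bounded {y. rad x0 y \<in> {a..b}}"
  proof (rule boundedI)
    fix y assume y: "y \<in> {y. rad x0 y \<in> {a..b}}"
    have "rad x0 y \<ge> 0" using ch_ge_1[of y] by (simp add: rad_eq)
    then have "ch x0 y \<le> cosh b" using y by (simp add: cosh_rad[symmetric] cosh_real_nonneg_le_iff)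
    then have "norm y * (c - norm p) \<le> cosh b" using ch_ge_norm[of y] by linarith
    then show "norm y \<le> cosh b / (c - norm p)" using norm_p_less by (simp add: pos_le_divide_eq)
  qed
  ultimately show "compact {y. rad x0 y \<in> {a..b}}" by (simp add: compact_eq_bounded_closed)
  show "a > 0 \<Longrightarrow> p \<notin> {y. rad x0 y \<in> {a..b}}" using ch_p by (simp add: rad_eq)
qed

text \<open>The intermediate value theorem for \<open>ch\<close> on the connected chart. It supplies
  the point where the integrand of the sharpness argument is strictly positive.\<close>

lemma rad_surj:
  assumes "r > 0" obtains y where "y \<noteq> p" "rad x0 y = r"
proof -
  obtain z :: "real ^ 'n" where z: "norm z = cosh r / (c - norm p)"
    using norm_p_less vector_choose_size[of "cosh r / (c - norm p)"] cosh_real_pos[of r] by auto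
  then have "ch x0 z \<ge> cosh r" using ch_ge_norm[of z] norm_p_less by simp
  moreover have "cosh r \<ge> ch x0 p" using ch_p cosh_real_ge_1[of r] by simp
  ultimately have "cosh r \<in> {ch x0 p..ch x0 z}" by simp
  moreover have "{ch x0 p..ch x0 z} \<subseteq> range (ch x0)"
    by (intro connected_contains_Icc connected_continuous_image continuous_on_ch connected_UNIV) auto
  ultimately obtain y where "ch x0 y = cosh r" by auto
  then have "rad x0 y = r" using assms by (simp add: rad_eq arcosh_cosh_real)
  moreover have "y \<noteq> p" using calculation assms ch_p by (auto simp: rad_eq)
  ultimately show thesis using that by blast
qed

lemma radial_test_function:
  assumes sm: "\<And>k. times_cont_diff_on k (- {p}) (\<lambda>y. G (rad x0 y))"
    and G0: "\<And>r. r > 0 \<Longrightarrow> r \<notin> {a..b} \<Longrightarrow> G r = 0" and "a > 0"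
  shows "(\<lambda>x. G (hyp_dist x x0)) \<in> test_functions x0"
proof -
  let ?K = "{y. rad x0 y \<in> {a..b}}"
  have eq: "{y. graph_chart y \<noteq> x0} = - {p}" by (auto simp: graph_chart_neq_x0)
  have "continuous_on UNIV (graph_chart :: real ^ 'n \<Rightarrow> 'n mink)"
    unfolding graph_chart_def[abs_def] by (intro continuous_intros)
  then have "compact (graph_chart ` ?K)"
    by (intro compact_continuous_image compact_annulus) (auto intro: continuous_on_subset)
  moreover have "graph_chart ` ?K \<subseteq> hyperbolic_space - {x0}"
  proof (rule image_subsetI)
    fix y assume "y \<in> ?K"
    then have "y \<noteq> p" using annulus_pole[OF assms(3), of b] by blast
    then show "graph_chart y \<in> hyperbolic_space - {x0}"
      using graph_chart_in_hyperbolic_space[of y] graph_chart_neq_x0[of y] by simp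
  qed
  moreover have "G (hyp_dist x x0) = 0" if "x \<in> hyperbolic_space - {x0} - graph_chart ` ?K" for x
  proof -
    have x: "graph_chart (fst x) = x" using that by (intro graph_chart_fst) simp
    then have "fst x \<noteq> p" using that graph_chart_neq_x0[of "fst x"] by auto
    moreover have "fst x \<notin> ?K" using that image_eqI[of x graph_chart "fst x" ?K] x by auto
    ultimately show ?thesis using G0[of "rad x0 (fst x)"] rad_pos[of "fst x"] x by (simp add: rad_def)
  qed
  ultimately show ?thesis
    using sm unfolding test_functions_def smooth_on_def eq rad_def[symmetric] mem_Collect_eq
    by (intro conjI allI exI[of _ "graph_chart ` ?K"]) auto
qed

text \<open>By the identity the constant can be raised by e for a given u only if the remainder is
  at least e times the integral of u_r^2 / sinh^2; the u obtained here violates this.\<close>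

lemma rellich_sharp:
  fixes lam e :: real
  assumes n: "CARD('n) \<ge> 5" and e: "e > 0"
  obtains u where "u \<in> test_functions x0"
    and "(\<integral>x. (Psi CARD('n) lam (hyp_dist x x0))\<^sup>2
            * sq_norm (radial_grad x0
                (\<lambda>y. radial_deriv x0 u y / Psi CARD('n) lam (hyp_dist y x0)) x) \<partial>hyp_volume)
      < e * (\<integral>x. sq_norm (radial_grad x0 u x) / (sinh (hyp_dist x x0))\<^sup>2 \<partial>hyp_volume)"
proof -
  let ?n = "CARD('n)"
  define \<alpha> where "\<alpha> = 2 - real ?n / 2"
  define \<beta> where "\<beta> = (real ?n - 1 + gam ?n lam) / 2"
  define T where "T = (2::real) ^ (?n - 1)"
  obtain \<eta> \<eta>1 \<eta>2 :: "real \<Rightarrow> real" where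
    d\<eta>: "\<And>t. (\<eta> has_real_derivative \<eta>1 t) (at t)" and d\<eta>1: "\<And>t. (\<eta>1 has_real_derivative \<eta>2 t) (at t)"
    and c\<eta>2: "continuous_on UNIV \<eta>2"
    and \<eta>0: "\<And>t. t \<notin> {-2<..<-1} \<Longrightarrow> \<eta> t = 0 \<and> \<eta>1 t = 0 \<and> \<eta>2 t = 0"
    and \<eta>pos: "\<And>t. t \<in> {-2<..<-1} \<Longrightarrow> \<eta> t > 0"
    and \<eta>tcd: "\<And>k S (f :: real ^ 'n \<Rightarrow> real). open S \<Longrightarrow> times_cont_diff_on k S f
           \<Longrightarrow> times_cont_diff_on k S (\<lambda>x. \<eta> (f x))"
    by (rule smooth_bump[where 'n = 'n]) (rule that)
  have c\<eta>: "continuous_on UNIV \<eta>" "continuous_on UNIV \<eta>1"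
    using d\<eta> d\<eta>1 by (auto intro!: continuous_at_imp_continuous_on DERIV_isCont)
  \<comment> \<open>N \<ge> 5 makes \<alpha> negative, so the leading term \<alpha>^2 \<eta>^2 of
    \<psi>^2 is present and dominates the terms with powers of 1 / k.\<close>
  have \<alpha>: "\<alpha>\<^sup>2 > 0" using n by (simp add: \<alpha>_def)
  obtain a Q where dQ: "\<And>t. (Q has_real_derivative (\<alpha>\<^sup>2 * (\<eta>1 t)\<^sup>2 + (\<eta>2 t)\<^sup>2) - a * (\<eta> t)\<^sup>2) (at t)"
    and Q0: "\<And>t. t \<notin> {-2<..<-1} \<Longrightarrow> Q t = 0"
  proof (rule compactly_supported_antiderivative[of "-2" "-1" "\<lambda>t. \<alpha>\<^sup>2 * (\<eta>1 t)\<^sup>2 + (\<eta>2 t)\<^sup>2" "\<lambda>t. (\<eta> t)\<^sup>2"])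
    show "continuous_on UNIV (\<lambda>t. \<alpha>\<^sup>2 * (\<eta>1 t)\<^sup>2 + (\<eta>2 t)\<^sup>2)" "continuous_on UNIV (\<lambda>t. (\<eta> t)\<^sup>2)"
      by (intro continuous_intros c\<eta> c\<eta>2)+
    show "(\<eta> t)\<^sup>2 > 0" if "t \<in> {-2<..<-1}" for t using \<eta>pos[OF that] by simp
  qed (use \<eta>0 in auto)
  obtain d where d: "d > 0"
    "\<And>r. 0 < r \<Longrightarrow> r < d \<Longrightarrow> sinh r / r \<le> 2 \<and> 2 * T * (- \<beta>)\<^sup>2 * (r * coth r - 1)\<^sup>2 \<le> e / 2"
    using small_radius[of "e / 2" "2 * T * (- \<beta>)\<^sup>2"] e by auto
  \<comment> \<open>Chosen last: \<eta>, and with it \<open>a\<close> and \<open>Q\<close>, do not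
    involve k, so the term with 1 / k^2 can be pushed below e \<alpha>^2 / 2. The condition exp (-k)
    < d puts the support where the small-radius estimates hold.\<close>
  obtain k where k: "k \<ge> 1" "exp (- k) < d" "e / 2 * \<alpha>\<^sup>2 - 4 * T * a / k\<^sup>2 > 0"
  proof -
    have "((\<lambda>k::real. 4 * T * a / k\<^sup>2) \<longlongrightarrow> 0) at_top" by real_asymp
    then have "eventually (\<lambda>k::real. 4 * T * a / k\<^sup>2 < e / 2 * \<alpha>\<^sup>2) at_top"
      by (rule order_tendstoD) (use e \<alpha> in simp)
    moreover have "((\<lambda>k::real. exp (- k)) \<longlongrightarrow> 0) at_top" by real_asymp
    then have "eventually (\<lambda>k::real. exp (- k) < d) at_top" by (rule order_tendstoD) (rule d(1))
    moreover have "eventually (\<lambda>k::real. k \<ge> 1) at_top" by (rule eventually_ge_at_top)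
    ultimately have "eventually (\<lambda>k::real. k \<ge> 1 \<and> exp (- k) < d \<and> e / 2 * \<alpha>\<^sup>2 - 4 * T * a / k\<^sup>2 > 0) at_top"
      by eventually_elim simp
    then show thesis using that eventually_happens[of _ "at_top :: real filter"] by fastforce
  qed
  define \<kappa> where "\<kappa> = e / 2 * \<alpha>\<^sup>2 - 4 * T * a / k\<^sup>2"
  \<comment> \<open>The operator r d/dr turns r^\<alpha> v(ln r / k) into r^\<alpha> (\<alpha> v +
    v' / k). Thus \<psi> is the profile of u_r, and \<psi>1 is the derivative of \<psi>.\<close>
  define \<psi> where "\<psi> t = \<alpha> * \<eta> t + \<eta>1 t / k" for t
  define \<psi>1 where "\<psi>1 t = \<alpha> * \<eta>1 t + \<eta>2 t / k" for t
  define Q' where "Q' t = \<alpha>\<^sup>2 * (\<eta>1 t)\<^sup>2 + (\<eta>2 t)\<^sup>2 - a * (\<eta> t)\<^sup>2" for t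
  \<comment> \<open>Gathers the exact derivatives in the lower bound, those of \<eta>^2 / 2 and of
    \<open>Q\<close>, into one function that vanishes outside the support interval of the
    bump.\<close>
  define P where "P t = e * \<alpha> / (2 * k) * (\<eta> t)\<^sup>2 - 4 * T / k\<^sup>2 * Q t" for t
  define P' where "P' t = e * \<alpha> / k * (\<eta> t * \<eta>1 t) - 4 * T / k\<^sup>2 * Q' t" for t
  have d\<psi>: "(\<psi> has_real_derivative \<psi>1 t) (at t)" for t
    unfolding \<psi>_def[abs_def] \<psi>1_def using k(1) by (auto intro!: derivative_eq_intros d\<eta> d\<eta>1)
  have dP: "(P has_real_derivative P' t) (at t)" for t
    unfolding P_def[abs_def] P'_def Q'_def
    by (rule DERIV_cong[OF DERIV_diff[OF DERIV_cmult[OF DERIV_power[OF d\<eta>, of 2]] DERIV_cmult[OF dQ]]]) simp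
  define \<tau> where "\<tau> r = ln r / k" for r
  have d\<tau>: "(\<tau> has_real_derivative 1 / (r * k)) (at r)" if "r > 0" for r
    unfolding \<tau>_def[abs_def] using that k(1) by (auto intro!: derivative_eq_intros)
  have \<tau>range: "exp (- 2 * k) < r" "r < exp (- k)" if "r > 0" "\<tau> r \<in> {-2<..<-1}" for r
  proof -
    have "- 2 * k < ln r" "ln r < - k" using that(2) k(1) by (auto simp: \<tau>_def field_simps)
    then show "exp (- 2 * k) < r" "r < exp (- k)" using that(1) by (metis exp_less_mono exp_ln)+
  qed
  define G where "G r = r powr \<alpha> * \<eta> (\<tau> r)" for r
  define G1 where "G1 r = r powr (\<alpha> - 1) * \<psi> (\<tau> r)" for r
  define G2 where "G2 r = r powr (\<alpha> - 2) * ((\<alpha> - 1) * \<psi> (\<tau> r) + \<psi>1 (\<tau> r) / k)" for r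
  have pw: "r powr (\<alpha> - 1) = r powr (\<alpha> - 2) * r" "r powr \<alpha> = r powr (\<alpha> - 2) * r * r" if "r > 0" for r
    using that by (simp_all add: powr_diff power2_eq_square)
  have dG: "(G has_real_derivative G1 r) (at r)" if r: "r > 0" for r
    unfolding G_def[abs_def] G1_def \<psi>_def
    by (rule DERIV_cong[OF DERIV_mult[OF has_real_derivative_powr[OF r] DERIV_chain2[OF d\<eta> d\<tau>[OF r]]]])
      (use r k(1) in \<open>simp add: pw field_simps\<close>)
  have dG1: "(G1 has_real_derivative G2 r) (at r)" if r: "r > 0" for r
    unfolding G1_def[abs_def] G2_def
    by (rule DERIV_cong[OF DERIV_mult[OF has_real_derivative_powr[OF r] DERIV_chain2[OF d\<psi> d\<tau>[OF r]]]])
      (use r k(1) in \<open>simp add: pw field_simps\<close>)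
  have rp: "rad x0 y > 0" "rad x0 y \<noteq> 0" "sinh (rad x0 y) \<noteq> 0" "sinh (rad x0 y) > 0" if "y \<noteq> p" for y
    using rad_pos[OF that] by auto
  have t\<tau>: "times_cont_diff_on j (- {p}) (\<lambda>y. \<tau> (rad x0 y))" for j
  proof -
    have "times_cont_diff_on j (- {p}) (\<lambda>y. ln (rad x0 y) * (1 / k))"
      by (intro times_cont_diff_on_mult times_cont_diff_on_const times_cont_diff_on_ln times_cont_diff_on_rad open_punctured)
        (simp add: rp)
    then show ?thesis by (simp add: \<tau>_def)
  qed
  have tG: "times_cont_diff_on j (- {p}) (\<lambda>y. G (rad x0 y))" for j
    unfolding G_def
    by (intro times_cont_diff_on_mult times_cont_diff_on_powr times_cont_diff_on_rad open_punctured \<eta>tcd t\<tau>)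
      (simp add: rp)
  define u where "u x = G (hyp_dist x x0)" for x
  have ug: "u (graph_chart y) = G (rad x0 y)" for y by (simp add: u_def rad_def)
  have u: "u \<in> test_functions x0"
    unfolding u_def[abs_def]
  proof (rule radial_test_function[OF tG])
    show "G r = 0" if "r > 0" "r \<notin> {exp (- 2 * k)..exp (- k)}" for r
      using \<tau>range[of r] that \<eta>0[of "\<tau> r"] by (fastforce simp: G_def)
  qed simp
  let ?K = "{y. rad x0 y \<in> {exp (- 2 * k)..exp (- k)}}"
  have K: "compact ?K" "p \<notin> ?K" by (rule compact_annulus, rule annulus_pole) simp
  have out: "\<tau> (rad x0 y) \<notin> {-2<..<-1}" if "y \<noteq> p" "y \<notin> ?K" for y
    using \<tau>range[OF rp(1)[OF that(1)]] that(2) by fastforce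
  define f where "f = chart_radial_deriv x0 (\<lambda>y. G (rad x0 y))"
  have f: "f y = G1 (rad x0 y)" if "y \<noteq> p" for y
    unfolding f_def using chart_radial_deriv_compose_rad(2)[OF that dG[OF rp(1)[OF that]]] .
  have tf: "times_cont_diff_on 1 (- {p}) f"
    unfolding f_def by (intro times_cont_diff_on_chart_radial_deriv tG)
  have g: "chart_radial_deriv x0 f y = G2 (rad x0 y)" if "y \<noteq> p" for y
    using chart_radial_deriv_compose_rad[OF that dG1[OF rp(1)[OF that]]]
      chart_radial_deriv_cong[of "\<lambda>z. G1 (rad x0 z)" f y] f that by simp
  have rf: "radial_deriv x0 u (graph_chart z) = f z" if "z \<noteq> p" for z
    unfolding f_def using that tG[of 1] by (intro radial_deriv_chart) (simp_all add: ug)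
  let ?I3 = "\<lambda>x. sq_norm (radial_grad x0 u x) / (sinh (hyp_dist x x0))\<^sup>2"
  let ?I5 = "\<lambda>x. (Psi ?n lam (hyp_dist x x0))\<^sup>2
            * sq_norm (radial_grad x0 (\<lambda>y. radial_deriv x0 u y / Psi ?n lam (hyp_dist y x0)) x)"
  let ?dv = "\<lambda>x. P' (\<tau> (hyp_dist x x0)) / (hyp_dist x x0 * sinh (hyp_dist x x0) ^ (?n - 1))"
  \<comment> \<open>Radial profiles of \<open>?I3\<close>, \<open>?I5\<close> and
    \<open>?dv\<close>, with the powers of r combined.\<close>
  define F3 where "F3 r = (\<psi> (\<tau> r))\<^sup>2 / r ^ (?n - 2) / (sinh r)\<^sup>2" for r
  define F5 where "F5 r = (\<psi>1 (\<tau> r) / k - (- \<beta>) * (r * coth r - 1) * \<psi> (\<tau> r))\<^sup>2 / r ^ ?n" for r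
  define FP where "FP r = P' (\<tau> r) / (r * sinh r ^ (?n - 1))" for r
  have I3: "?I3 (graph_chart y) = F3 (rad x0 y)" if "y \<noteq> p" for y
  proof -
    let ?r = "rad x0 y"
    have "(?r powr (\<alpha> - 1))\<^sup>2 = ?r powr (- real (?n - 2))"
      using n rp(1)[OF that] by (simp add: power2_eq_square powr_add[symmetric] \<alpha>_def of_nat_diff)
    also have "\<dots> = 1 / ?r ^ (?n - 2)"
      using rp(1)[OF that] by (simp add: powr_minus_divide powr_realpow)
    finally show ?thesis
      using that by (simp add: sq_norm_radial_grad_chart rf f G1_def F3_def power_mult_distrib rad_def[symmetric])
  qed
  have I5: "?I5 (graph_chart y) = F5 (rad x0 y)" if "y \<noteq> p" for y
  proof -
    let ?r = "rad x0 y"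
    have "(?r powr (\<alpha> - 2))\<^sup>2 = ?r powr (- real ?n)"
      using rp(1)[OF that] by (simp add: power2_eq_square powr_add[symmetric] \<alpha>_def)
    also have "\<dots> = 1 / ?r ^ ?n"
      using rp(1)[OF that] by (simp add: powr_minus_divide powr_realpow)
    finally have sq: "(?r powr (\<alpha> - 2))\<^sup>2 = 1 / ?r ^ ?n" .
    have "?I5 (graph_chart y) = (G2 ?r - Psi_log_deriv ?n lam ?r * G1 ?r)\<^sup>2"
      using that Psi_pos[OF rp(1)[OF that], of ?n lam]
      by (simp add: sq_norm_radial_grad_chart radial_deriv_div_Psi_chart[OF that tf rf] g f rad_def[symmetric] power_divide)
    also have "Psi_log_deriv ?n lam ?r = (\<alpha> - 1 - \<beta> * (?r * coth ?r - 1)) / ?r"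
      using Psi_log_deriv_eq[OF rp(1)[OF that], of ?n lam] by (simp add: \<alpha>_def \<beta>_def)
    \<comment> \<open>The terms with \<alpha> - 1 cancel, since \<alpha> - 1 = 1 - N/2 is also the
      leading coefficient of \<open>Psi_log_deriv\<close>. Each remaining term carries 1 / k or r
      coth r - 1, hence is small.\<close>
    also have "G2 ?r - (\<alpha> - 1 - \<beta> * (?r * coth ?r - 1)) / ?r * G1 ?r =
        ?r powr (\<alpha> - 2) * (\<psi>1 (\<tau> ?r) / k - (- \<beta>) * (?r * coth ?r - 1) * \<psi> (\<tau> ?r))"
      using rp(1)[OF that] by (simp add: G1_def G2_def pw(1)) (simp add: algebra_simps)
    finally show ?thesis by (simp add: power_mult_distrib sq F5_def)
  qed
  have zero: "\<eta> (\<tau> r) = 0" "\<eta>1 (\<tau> r) = 0" "\<eta>2 (\<tau> r) = 0" "\<psi> (\<tau> r) = 0" "\<psi>1 (\<tau> r) = 0" "Q (\<tau> r) = 0"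
    "P (\<tau> r) = 0" "P' (\<tau> r) = 0" if "\<tau> r \<notin> {-2<..<-1}" for r
    using \<eta>0[OF that] Q0[OF that] by (simp_all add: \<psi>_def \<psi>1_def P_def P'_def Q'_def)
  have bound: "\<kappa> * (\<eta> (\<tau> r))\<^sup>2 / (r * sinh r ^ (?n - 1)) \<le> e * F3 r - F5 r - FP r" if r: "r > 0" for r
  proof (cases "\<tau> r \<in> {-2<..<-1}")
    case True
    then have "r < d" using \<tau>range(2)[OF r True] k(2) by simp
    note dr = d(2)[OF r this]
    have "\<kappa> * (\<eta> (\<tau> r))\<^sup>2 / (r * sinh r ^ (?n - 1)) + FP r \<le> e * F3 r - F5 r"
      using remainder_lower_bound[where n = ?n and r = r and k = k and e = e and S = "sinh r" and b = "- \<beta>"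
          and w = "r * coth r - 1" and q' = "Q' (\<tau> r)" and \<alpha> = \<alpha> and ?H1.0 = "\<eta>1 (\<tau> r)" and ?H2.0 = "\<eta>2 (\<tau> r)"
          and H = "\<eta> (\<tau> r)" and c = a] n r k(1) e dr sinh_ge_self[of r]
      unfolding \<kappa>_def F3_def F5_def FP_def P'_def \<psi>_def \<psi>1_def T_def Q'_def
      by simp
    then show ?thesis by simp
  next
    case False
    then show ?thesis by (simp add: zero F3_def F5_def FP_def)
  qed
  have c\<tau>: "continuous_on (- {p}) (\<lambda>y. \<tau> (rad x0 y))" using times_cont_diff_on_imp_continuous[OF t\<tau>] .
  have comp: "continuous_on (- {p}) (\<lambda>y. v (\<tau> (rad x0 y)))" if "continuous_on UNIV v" for v :: "real \<Rightarrow> real"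
    by (rule continuous_on_compose2[OF that c\<tau>]) simp
  have c\<psi>: "continuous_on UNIV \<psi>" "continuous_on UNIV \<psi>1" "continuous_on UNIV P'"
    unfolding \<psi>_def[abs_def] \<psi>1_def[abs_def] P'_def[abs_def] Q'_def
    using k(1) by (auto intro!: continuous_intros c\<eta> c\<eta>2)
  note ci = continuous_intros comp c\<psi> continuous_on_rad continuous_on_coth_rad
  have cF: "continuous_on (- {p}) (\<lambda>y. F3 (rad x0 y))" "continuous_on (- {p}) (\<lambda>y. F5 (rad x0 y))"
      "continuous_on (- {p}) (\<lambda>y. FP (rad x0 y))"
    unfolding F3_def F5_def FP_def using k(1) by (auto intro!: ci simp: rp)
  have F0: "F3 (rad x0 y) = 0" "F5 (rad x0 y) = 0" "FP (rad x0 y) = 0" if "y \<noteq> p" "y \<notin> ?K" for y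
    using zero[OF out[OF that]] by (simp_all add: F3_def F5_def FP_def)
  have dv: "?dv (graph_chart y) = FP (rad x0 y)" for y by (simp add: FP_def rad_def[symmetric])
  have i3: "integrable hyp_volume ?I3" by (rule hyp_volume_integrable[OF cF(1) K F0(1) I3])
  have i5: "integrable hyp_volume ?I5" by (rule hyp_volume_integrable[OF cF(2) K F0(2) I5])
  \<comment> \<open>The denominator sinh^(N - 1) cancels the volume growth, so the divergence of the
    radial field with coefficient \<Phi> has no zeroth-order term in P. The factor k compensates the
    derivative 1 / (r k) of \<tau>.\<close>
  define \<Phi> where "\<Phi> r = k * P (\<tau> r) / sinh r ^ (?n - 1)" for r
  have div0: "has_bochner_integral hyp_volume ?dv 0"
  proof (rule hyp_volume_radial_divergence[OF _ K])
    show "\<Phi> (rad x0 y) = 0" if "y \<noteq> p" "y \<notin> ?K" for y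
      using zero(7)[OF out[OF that]] by (simp add: \<Phi>_def)
    have cQ: "times_cont_diff_on (Suc 0) (- {p}) (\<lambda>y. Q (\<tau> (rad x0 y)))"
    proof (rule times_cont_diff_on_chain[where G = Q and f = "\<lambda>y. \<tau> (rad x0 y)", OF open_punctured t\<tau> dQ])
      have "continuous_on UNIV (\<lambda>t. (\<alpha>\<^sup>2 * (\<eta>1 t)\<^sup>2 + (\<eta>2 t)\<^sup>2) - a * (\<eta> t)\<^sup>2)"
        by (intro continuous_intros c\<eta> c\<eta>2)
      from comp[OF this] show "times_cont_diff_on 0 (- {p})
        (\<lambda>y. (\<alpha>\<^sup>2 * (\<eta>1 (\<tau> (rad x0 y)))\<^sup>2 + (\<eta>2 (\<tau> (rad x0 y)))\<^sup>2) - a * (\<eta> (\<tau> (rad x0 y)))\<^sup>2)"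
        by simp
    qed
    have "times_cont_diff_on (Suc 0) (- {p}) (\<lambda>y. k * (e * \<alpha> / (2 * k) * (\<eta> (\<tau> (rad x0 y)) * \<eta> (\<tau> (rad x0 y)))
        + (- (4 * T / k\<^sup>2)) * Q (\<tau> (rad x0 y))) * sh x0 y powr (- real (?n - 1)))"
      by (intro times_cont_diff_on_mult times_cont_diff_on_add times_cont_diff_on_const open_punctured
          times_cont_diff_on_sh_powr \<eta>tcd t\<tau> cQ)
    then have "times_cont_diff_on (Suc 0) (- {p}) (\<lambda>y. \<Phi> (rad x0 y))"
    proof (rule times_cont_diff_on_cong[OF open_punctured, rotated])
      fix y assume "y \<in> - {p}"
      then have "sh x0 y > 0" using sh_pos by simp
      then have "sh x0 y powr (- real (?n - 1)) = 1 / sinh (rad x0 y) ^ (?n - 1)"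
        by (simp only: powr_minus_divide powr_realpow sinh_rad)
      then show "k * (e * \<alpha> / (2 * k) * (\<eta> (\<tau> (rad x0 y)) * \<eta> (\<tau> (rad x0 y)))
        + (- (4 * T / k\<^sup>2)) * Q (\<tau> (rad x0 y))) * sh x0 y powr (- real (?n - 1)) = \<Phi> (rad x0 y)"
        by (simp add: \<Phi>_def P_def power2_eq_square[of "\<eta> _"])
    qed
    then show "times_cont_diff_on 1 (- {p}) (\<lambda>y. \<Phi> (rad x0 y))" by simp
    fix y assume y: "y \<noteq> p"
    let ?r = "rad x0 y"
    define j where "j = ?n - 2"
    have nj: "?n - 1 = Suc j" "real ?n - 1 = real (Suc j)" using n by (simp_all add: j_def of_nat_diff)
    have "(\<Phi> has_real_derivative (k * (P' (\<tau> ?r) * (1 / (?r * k))) * sinh ?r ^ (?n - 1)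
        - k * P (\<tau> ?r) * (real (?n - 1) * (cosh ?r * sinh ?r ^ (?n - 1 - 1)))) / (sinh ?r ^ (?n - 1) * sinh ?r ^ (?n - 1))) (at ?r)"
      unfolding \<Phi>_def[abs_def] using rp[OF y]
      by (auto intro!: derivative_eq_intros DERIV_chain2[OF dP d\<tau>])
    moreover have "(k * (P' (\<tau> ?r) * (1 / (?r * k))) * sinh ?r ^ (?n - 1)
        - k * P (\<tau> ?r) * (real (?n - 1) * (cosh ?r * sinh ?r ^ (?n - 1 - 1)))) / (sinh ?r ^ (?n - 1) * sinh ?r ^ (?n - 1))
      = FP ?r - (real ?n - 1) * coth ?r * \<Phi> ?r"
      unfolding FP_def \<Phi>_def coth_def nj using rp[OF y] k(1) by (simp add: field_simps)
    ultimately have "chart_radial_deriv x0 (\<lambda>y. \<Phi> (rad x0 y)) y = FP ?r - (real ?n - 1) * coth ?r * \<Phi> ?r"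
      using chart_radial_deriv_compose_rad(2)[OF y, of \<Phi>] by simp
    then show "?dv (graph_chart y) = chart_radial_deriv x0 (\<lambda>y. \<Phi> (rad x0 y)) y + (real ?n - 1) * coth (rad x0 y) * \<Phi> (rad x0 y)"
      unfolding dv by simp
  qed
  \<comment> \<open>The midpoint t = -3/2 of the bump's support.\<close>
  obtain y1 where y1: "y1 \<noteq> p" "rad x0 y1 = exp (- (3 / 2) * k)"
    using rad_surj[of "exp (- (3 / 2) * k)"] by auto
  have "\<tau> (rad x0 y1) = - (3 / 2)" using k(1) by (simp add: \<tau>_def y1(2))
  then have \<eta>y1: "\<eta> (\<tau> (rad x0 y1)) > 0" using \<eta>pos by simp
  have low: "0 \<le> \<kappa> * (\<eta> (\<tau> (rad x0 y)))\<^sup>2 / (rad x0 y * sinh (rad x0 y) ^ (?n - 1))" if "y \<noteq> p" for y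
    using k(3) rp[OF that] by (intro divide_nonneg_nonneg mult_nonneg_nonneg) (auto simp: \<kappa>_def)
  have "integral\<^sup>L hyp_volume (\<lambda>x. e * ?I3 x - ?I5 x - ?dv x) > 0"
  proof (rule hyp_volume_integral_pos[where F = "\<lambda>y. e * F3 (rad x0 y) - F5 (rad x0 y) - FP (rad x0 y)", OF _ K])
    show "continuous_on (- {p}) (\<lambda>y. e * F3 (rad x0 y) - F5 (rad x0 y) - FP (rad x0 y))"
      by (intro continuous_intros cF)
    show "e * F3 (rad x0 y) - F5 (rad x0 y) - FP (rad x0 y) \<ge> 0" if "y \<noteq> p" for y
      using low[OF that] bound[OF rp(1)[OF that]] by linarith
    have "0 < \<kappa> * (\<eta> (\<tau> (rad x0 y1)))\<^sup>2 / (rad x0 y1 * sinh (rad x0 y1) ^ (?n - 1))"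
      using k(3) rp[OF y1(1)] \<eta>y1 by (intro divide_pos_pos mult_pos_pos) (auto simp: \<kappa>_def)
    then show "e * F3 (rad x0 y1) - F5 (rad x0 y1) - FP (rad x0 y1) > 0"
      using bound[OF rp(1)[OF y1(1)]] by linarith
    show "e * ?I3 (graph_chart y) - ?I5 (graph_chart y) - ?dv (graph_chart y)
        = e * F3 (rad x0 y) - F5 (rad x0 y) - FP (rad x0 y)" if "y \<noteq> p" for y
      by (simp only: I3[OF that] I5[OF that] dv)
    show "e * F3 (rad x0 y) - F5 (rad x0 y) - FP (rad x0 y) = 0" if "y \<noteq> p" "y \<notin> ?K" for y
      using F0[OF that] by simp
  qed (rule y1)
  moreover have "has_bochner_integral hyp_volume (\<lambda>x. e * ?I3 x - ?I5 x - ?dv x)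
      (e * integral\<^sup>L hyp_volume ?I3 - integral\<^sup>L hyp_volume ?I5 - 0)"
    using i3 i5 div0 by (intro has_bochner_integral_diff has_bochner_integral_mult_right) (simp_all add: has_bochner_integral_iff)
  ultimately have "integral\<^sup>L hyp_volume ?I5 < e * integral\<^sup>L hyp_volume ?I3"
    by (simp add: has_bochner_integral_iff)
  with u show thesis by (rule that)
qed

end

theorem theorem2p1:
  fixes x0 :: "'n::finite mink" and lam :: real
  assumes "CARD('n) \<ge> 2"
    and "x0 \<in> hyperbolic_space"
    and "0 \<le> lam" and "lam \<le> ((real CARD('n) - 1) / 2)\<^sup>2"
  shows "(\<forall>u \<in> test_functions x0.
      (\<integral>x. \<bar>radial_laplacian x0 u x\<bar>\<^sup>2 \<partial>hyp_volume) =
        lam * (\<integral>x. sq_norm (radial_grad x0 u x) \<partial>hyp_volume)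
        + (h CARD('n) lam)\<^sup>2 *
            (\<integral>x. sq_norm (radial_grad x0 u x) / (hyp_dist x x0)\<^sup>2 \<partial>hyp_volume)
        + ((real CARD('n) / 2)\<^sup>2 - (h CARD('n) lam)\<^sup>2) *
            (\<integral>x. sq_norm (radial_grad x0 u x) / (sinh (hyp_dist x x0))\<^sup>2 \<partial>hyp_volume)
        + gam CARD('n) lam * h CARD('n) lam *
            (\<integral>x. (hyp_dist x x0 * coth (hyp_dist x x0) - 1) / (hyp_dist x x0)\<^sup>2
                   * sq_norm (radial_grad x0 u x) \<partial>hyp_volume)
        + (\<integral>x. (Psi CARD('n) lam (hyp_dist x x0))\<^sup>2
                 * sq_norm (radial_grad x0
                     (\<lambda>y. radial_deriv x0 u y / Psi CARD('n) lam (hyp_dist y x0)) x) \<partial>hyp_volume))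
    \<and>
    (CARD('n) \<ge> 5 \<longrightarrow>
      (\<forall>C > (real CARD('n) / 2)\<^sup>2 - (h CARD('n) lam)\<^sup>2. \<exists>u \<in> test_functions x0.
        \<not> ((\<integral>x. \<bar>radial_laplacian x0 u x\<bar>\<^sup>2 \<partial>hyp_volume) \<ge>
            lam * (\<integral>x. sq_norm (radial_grad x0 u x) \<partial>hyp_volume)
            + (h CARD('n) lam)\<^sup>2 *
                (\<integral>x. sq_norm (radial_grad x0 u x) / (hyp_dist x x0)\<^sup>2 \<partial>hyp_volume)
            + C *
                (\<integral>x. sq_norm (radial_grad x0 u x) / (sinh (hyp_dist x x0))\<^sup>2 \<partial>hyp_volume)
            + gam CARD('n) lam * h CARD('n) lam *
                (\<integral>x. (hyp_dist x x0 * coth (hyp_dist x x0) - 1) / (hyp_dist x x0)\<^sup>2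
                       * sq_norm (radial_grad x0 u x) \<partial>hyp_volume))))"
proof -
  interpret pole x0 by (rule pole.intro) (rule assms(2))
  note I = rellich_identity[OF assms(1) _ assms(4)]
  show ?thesis
  proof (intro conjI impI allI ballI)
    fix C assume n: "CARD('n) \<ge> 5" and C: "C > (real CARD('n) / 2)\<^sup>2 - (h CARD('n) lam)\<^sup>2"
    \<comment> \<open>The fraction e is the excess of C over the sharp constant. Once the identity
      replaces the left side, all common terms cancel, and the inequality fails exactly when the
      remainder is below this excess times the integral.\<close>
    obtain u where u: "u \<in> test_functions x0"
      and less: "(\<integral>x. (Psi CARD('n) lam (hyp_dist x x0))\<^sup>2
            * sq_norm (radial_grad x0
                (\<lambda>y. radial_deriv x0 u y / Psi CARD('n) lam (hyp_dist y x0)) x) \<partial>hyp_volume)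
      < (C - ((real CARD('n) / 2)\<^sup>2 - (h CARD('n) lam)\<^sup>2)) *
        (\<integral>x. sq_norm (radial_grad x0 u x) / (sinh (hyp_dist x x0))\<^sup>2 \<partial>hyp_volume)"
      using rellich_sharp[OF n, of "C - ((real CARD('n) / 2)\<^sup>2 - (h CARD('n) lam)\<^sup>2)" lam] C by auto
    show "\<exists>u \<in> test_functions x0.
        \<not> ((\<integral>x. \<bar>radial_laplacian x0 u x\<bar>\<^sup>2 \<partial>hyp_volume) \<ge>
            lam * (\<integral>x. sq_norm (radial_grad x0 u x) \<partial>hyp_volume)
            + (h CARD('n) lam)\<^sup>2 *
                (\<integral>x. sq_norm (radial_grad x0 u x) / (hyp_dist x x0)\<^sup>2 \<partial>hyp_volume)
            + C *
                (\<integral>x. sq_norm (radial_grad x0 u x) / (sinh (hyp_dist x x0))\<^sup>2 \<partial>hyp_volume)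
            + gam CARD('n) lam * h CARD('n) lam *
                (\<integral>x. (hyp_dist x x0 * coth (hyp_dist x x0) - 1) / (hyp_dist x x0)\<^sup>2
                       * sq_norm (radial_grad x0 u x) \<partial>hyp_volume))"
      by (rule bexI[OF _ u], unfold I[OF u], use less in \<open>simp only: left_diff_distrib not_le\<close>)
  qed (rule I)
qed

end
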